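(* For every $n\in\{1,2,3,\dots,\omega\}$, the group $nV$ is generated by transpositions, and $nV$ is a simple group.
   Context: Let $n\in\{1,2,3,\dots\}\cup\{\omega\}$, and let $S=[0,1)^n$ be the product of $n$ copies of the half-open unit interval, where for $n=\omega$ this is the product of countably infinitely many copies, indexed by $\mathbb{N}$. A box is a product $\prod_i [a_i,b_i)\subseteq S$ over the $n$ coordinates. For a coordinate $j$, dividing a box $\prod_i [a_i,b_i)$ in direction $j$ means replacing it by the two boxes obtained by replacing the factor $[a_j,b_j)$ by $[a_j,\frac{a_j+b_j}{2})$ and by $[\frac{a_j+b_j}{2},b_j)$ respectively. A pattern is a finite partition of $S$ into boxes obtained from the trivial partition $\{S\}$ by a finite (possibly empty) sequence of steps, each dividing one box of the current partition in one of the $n$ coordinate directions. (In particular, when $n=\omega$, each box in a pattern has all but finitely many factors equal to $[0,1)$.) A numbered pattern is a pattern whose boxes are indexed $0,1,\dots,k-1$, where $k$ is the number of boxes. A pair of numbered patterns $(P_0,\dots,P_{k-1})$ (domain) and $(Q_0,\dots,Q_{k-1})$ (range) with the same number $k$ of boxes determines the bijection $S\to S$ that, for each $m$, carries $P_m=\prod_i[a_i,b_i)$ onto $Q_m=\prod_i[a_i',b_i')$ by acting in each coordinate $i$ by the increasing affine map $x_i\mapsto a_i'+\frac{b_i'-a_i'}{b_i-a_i}(x_i-a_i)$. The group $nV$ is the group, under composition, of all bijections of $S$ arising in this way. (Different pairs of numbered patterns may determine the same element. Equivalently, $nV$ can be viewed as a group of homeomorphisms of the product of $n$ Cantor sets.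 The group $1V$ is Thompson's group $V$, and $\omega V$ is the union of the groups $nV$, $n<\omega$, under the inclusions extending an element by the identity in the additional coordinates.) Transposition: an element of $nV$ given by a pair of numbered patterns whose underlying patterns are identical and whose numberings are identical except that two of the numbers are switched (so it interchanges two distinct boxes of one pattern by the coordinatewise increasing affine maps and is the identity on all other boxes of the pattern). *)

theory Defs
  imports Complex_Main "HOL-Library.Extended_Nat" "HOL-Library.FuncSet"
    "HOL-Algebra.Bij" "HOL-Algebra.Coset" "HOL-Algebra.Generated_Groups"
begin

text \<open>
  The dimension is an extended natural number: \<open>n < \<infinity>\<close> gives the coordinates \<open>0, \<dots>, n - 1\<close>,
  and \<open>n = \<infinity>\<close> stands for \<open>\<omega>\<close>, with all natural numbers as coordinates. Points are extensional
  functions on the coordinates, so that equality of points is equality of coordinates.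
\<close>

definition coords :: "enat \<Rightarrow> nat set" where
  "coords n = {i. enat i < n}"

definition half_open_box :: "enat \<Rightarrow> (nat \<Rightarrow> real) \<Rightarrow> (nat \<Rightarrow> real) \<Rightarrow> (nat \<Rightarrow> real) set" where
  "half_open_box n a b = (\<Pi>\<^sub>E i\<in>coords n. {a i..<b i})"

definition unit_cube :: "enat \<Rightarrow> (nat \<Rightarrow> real) set" where
  "unit_cube n = half_open_box n (\<lambda>_. 0) (\<lambda>_. 1)"

text \<open>The endpoints of a nonempty box are determined by the box as a set of points.\<close>

lemma half_open_box_eq_imp_endpoints_eq:
  assumes "half_open_box n a b = half_open_box n a' b'" "half_open_box n a b \<noteq> {}"
    and "i \<in> coords n"
  shows "a i = a' i" "b i = b' i"
proof -
  have "{a i..<b i} \<noteq> {}"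
    using assms(2,3) by (auto simp: half_open_box_def PiE_eq_empty_iff)
  moreover have "{a i..<b i} = {a' i..<b' i}"
    using assms unfolding half_open_box_def PiE_eq by blast
  ultimately show "a i = a' i" "b i = b' i"
    by (simp_all add: Ico_eq_Ico)
qed

inductive pattern :: "enat \<Rightarrow> (nat \<Rightarrow> real) set set \<Rightarrow> bool" for n where
  trivial: "pattern n {unit_cube n}"
| divide: "pattern n (insert (half_open_box n a (b(j := (a j + b j) / 2)))
               (insert (half_open_box n (a(j := (a j + b j) / 2)) b)
                 (\<P> - {half_open_box n a b})))"
  if "pattern n \<P>" "half_open_box n a b \<in> \<P>" "j \<in> coords n"

text \<open>The box numbered \<open>m\<close> is the list entry \<open>P ! m\<close>.\<close>

definition numbered_pattern :: "enat \<Rightarrow> (nat \<Rightarrow> real) set list \<Rightarrow> bool" where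
  "numbered_pattern n P \<longleftrightarrow> distinct P \<and> pattern n (set P)"

definition affine_on_box ::
    "enat \<Rightarrow> (nat \<Rightarrow> real) set \<Rightarrow> (nat \<Rightarrow> real) set \<Rightarrow> ((nat \<Rightarrow> real) \<Rightarrow> nat \<Rightarrow> real) \<Rightarrow> bool" where
  "affine_on_box n B C f \<longleftrightarrow>
     (\<exists>a b a' b'. B = half_open_box n a b \<and> C = half_open_box n a' b' \<and>
        (\<forall>x\<in>B. f x = (\<lambda>i\<in>coords n. a' i + (b' i - a' i) / (b i - a i) * (x i - a i))))"

text \<open>
  \<open>f\<close> is the bijection of the cube determined by the domain \<open>P\<close> and the range \<open>Q\<close>. Since the boxes
  of \<open>P\<close> cover the cube and \<open>f\<close> is extensional, there is exactly one such \<open>f\<close>.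
\<close>

definition determines ::
    "enat \<Rightarrow> (nat \<Rightarrow> real) set list \<Rightarrow> (nat \<Rightarrow> real) set list \<Rightarrow> ((nat \<Rightarrow> real) \<Rightarrow> nat \<Rightarrow> real) \<Rightarrow> bool" where
  "determines n P Q f \<longleftrightarrow>
     numbered_pattern n P \<and> numbered_pattern n Q \<and> length P = length Q \<and>
     f \<in> Bij (unit_cube n) \<and> (\<forall>m<length P. affine_on_box n (P ! m) (Q ! m) f)"

definition nV :: "enat \<Rightarrow> ((nat \<Rightarrow> real) \<Rightarrow> nat \<Rightarrow> real) monoid" where
  "nV n = (BijGroup (unit_cube n))\<lparr>carrier := {f. \<exists>P Q. determines n P Q f}\<rparr>"

definition transposition :: "enat \<Rightarrow> ((nat \<Rightarrow> real) \<Rightarrow> nat \<Rightarrow> real) \<Rightarrow> bool" where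
  "transposition n f \<longleftrightarrow>
     (\<exists>P k l. k < length P \<and> l < length P \<and> k \<noteq> l \<and> determines n P (P[k := P ! l, l := P ! k]) f)"

text \<open>
  The library locale \<open>simple_group\<close> demands \<open>order G > 1\<close>, where the order is a natural number that
  is 0 for infinite groups; it therefore only covers finite groups.
\<close>

definition is_simple :: "('a, 'b) monoid_scheme \<Rightarrow> bool" where
  "is_simple G \<longleftrightarrow>
     group G \<and> carrier G \<noteq> {\<one>\<^bsub>G\<^esub>} \<and> (\<forall>N. N \<lhd> G \<longrightarrow> N = {\<one>\<^bsub>G\<^esub>} \<or> N = carrier G)"

end

theory Submission
  imports Defs "HOL-Combinatorics.Transposition"
begin

text \<open>
  \<^emph>\<open>Generation.\<close> Call two patterns equivalent if some element of the group \<open>H\<close> generated by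
  transpositions carries one to the other. Equivalence is preserved by dividing arbitrary boxes in
  the same direction on both sides, so it remains to see that dividing one box in direction \<open>i\<close> or
  \<open>j\<close> gives equivalent patterns, i.e. that the baker's map of each box lies in \<open>H\<close>. Modulo \<open>H\<close>
  the baker's maps of any two disjoint boxes agree, and the one of a box is the product of those
  of its halves; so \<open>b = b\<^sup>2\<close> modulo \<open>H\<close>.

  \<^emph>\<open>Simplicity.\<close> A nontrivial \<open>f\<close> in a normal subgroup \<open>N\<close> moves some small box off itself, and its
  commutator with a swap inside this box is a product of two disjoint swaps. All such products
  that fix a further box are conjugate, a swap of two boxes fixing a third one is such a product
  after halving the two boxes, and any transposition is a product of two swaps of this kind.
\<close>

section \<open>Boxes\<close>

text \<open>Two patterns with equally many boxes need not arise from parallel sequences of cuts. An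
  induction on cuts must therefore be able to exchange the direction of the last cut, and this
  exchange is a baker's map. Congruence modulo \<open>H\<close> means explicit quotients in
  \<open>H\<close>, multiplied so that they telescope. Since only disjoint boxes can be compared
  directly, a box and its half are compared through a third box disjoint from both; the whole cube
  leaves no room for one and is handled through its two halves. Composition needs a common
  refinement of the range of one element and the domain of the next; it exists because the sides of
  boxes are dyadic intervals, which are nested or disjoint. The bound 5 in the simplicity part is
  four swapped boxes and a spare one. Cutting the spare box brings two patterns to the same size,
  and then conjugacy is decided as in a finite symmetric group. Parity is no obstruction: halving
  both boxes of a swap turns an odd permutation of boxes into an even one.\<close>

locale cube =
  fixes n :: enat
  assumes dim_pos: "1 \<le> n"
begin

abbreviation "I \<equiv> coords n"
abbreviation "X \<equiv> unit_cube n"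

text \<open>Supplies the direction of all cuts whose direction does not matter, so that every
  dimension, finite or not, is treated alike.\<close>

lemma zero_coord: "0 \<in> I"
  using dim_pos by (cases n) (auto simp: coords_def one_enat_def zero_enat_def)

definition box :: "(nat \<Rightarrow> real) set \<Rightarrow> bool" where
  "box B \<longleftrightarrow> (\<exists>a b. (\<forall>i\<in>I. a i < b i) \<and> B = half_open_box n a b)"

text \<open>The endpoints of a nonempty box are determined only at the coordinates in
  \<open>I\<close>. \<open>lo\<close> and \<open>hi\<close> choose them independently, with
  arbitrary values at other indices, so facts about them are restricted to
  \<open>i \<in> I\<close>.\<close>

definition lo :: "(nat \<Rightarrow> real) set \<Rightarrow> nat \<Rightarrow> real" where
  "lo B = (SOME a. \<exists>b. B = half_open_box n a b)"

definition hi :: "(nat \<Rightarrow> real) set \<Rightarrow> nat \<Rightarrow> real" where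
  "hi B = (SOME b. \<exists>a. B = half_open_box n a b)"

text \<open>A formula for all \<open>x\<close> rather than a map on \<open>B\<close>, so that
  composing and halving become identities of formulas (\<open>aff_aff\<close>,
  \<open>aff_half\<close>). The restriction to \<open>I\<close> makes the value extensional.\<close>

definition aff :: "(nat \<Rightarrow> real) set \<Rightarrow> (nat \<Rightarrow> real) set \<Rightarrow> (nat \<Rightarrow> real) \<Rightarrow> nat \<Rightarrow> real" where
  "aff B C x = (\<lambda>i\<in>I. lo C i + (hi C i - lo C i) / (hi B i - lo B i) * (x i - lo B i))"

text \<open>The Boolean \<open>e\<close> selects the upper half. One statement then covers both
  halves, and a map that matches lower with lower and upper with upper halves is expressed by
  keeping \<open>e\<close>.\<close>

definition half :: "nat \<Rightarrow> bool \<Rightarrow> (nat \<Rightarrow> real) set \<Rightarrow> (nat \<Rightarrow> real) set" where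
  "half j e B =
     (if e then half_open_box n ((lo B)(j := (lo B j + hi B j) / 2)) (hi B)
      else half_open_box n (lo B) ((hi B)(j := (lo B j + hi B j) / 2)))"

lemma half_open_box_nonempty_iff: "half_open_box n a b \<noteq> {} \<longleftrightarrow> (\<forall>i\<in>I. a i < b i)"
  by (auto simp: half_open_box_def PiE_eq_empty_iff not_le)

lemma box_half_open_box: "(\<And>i. i \<in> I \<Longrightarrow> a i < b i) \<Longrightarrow> box (half_open_box n a b)"
  unfolding box_def by blast

lemma lo_half_open_box:
  assumes "\<And>i. i \<in> I \<Longrightarrow> a i < b i" "i \<in> I"
  shows "lo (half_open_box n a b) i = a i"
proof -
  have "\<exists>b'. half_open_box n a b = half_open_box n (lo (half_open_box n a b)) b'"
    unfolding lo_def by (rule someI[of _ a]) blast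
  then obtain b' where "half_open_box n a b = half_open_box n (lo (half_open_box n a b)) b'" ..
  with half_open_box_eq_imp_endpoints_eq(1)[OF this] half_open_box_nonempty_iff assms
  show ?thesis by simp
qed

lemma hi_half_open_box:
  assumes "\<And>i. i \<in> I \<Longrightarrow> a i < b i" "i \<in> I"
  shows "hi (half_open_box n a b) i = b i"
proof -
  have "\<exists>a'. half_open_box n a b = half_open_box n a' (hi (half_open_box n a b))"
    unfolding hi_def by (rule someI[of _ b]) blast
  then obtain a' where "half_open_box n a b = half_open_box n a' (hi (half_open_box n a b))" ..
  with half_open_box_eq_imp_endpoints_eq(2)[OF this] half_open_box_nonempty_iff assms
  show ?thesis by simp
qed

lemma half_open_box_cong:
  "(\<And>i. i \<in> I \<Longrightarrow> a i = a' i) \<Longrightarrow> (\<And>i. i \<in> I \<Longrightarrow> b i = b' i) \<Longrightarrow>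
   half_open_box n a b = half_open_box n a' b'"
  unfolding half_open_box_def by (intro PiE_cong) simp

lemma lo_less_hi: "box B \<Longrightarrow> i \<in> I \<Longrightarrow> lo B i < hi B i"
  unfolding box_def by (auto simp: lo_half_open_box hi_half_open_box)

lemma box_eq: "box B \<Longrightarrow> B = half_open_box n (lo B) (hi B)"
  unfolding box_def
  by (auto simp: lo_half_open_box hi_half_open_box intro!: half_open_box_cong)

lemma box_eqI:
  "box B \<Longrightarrow> box C \<Longrightarrow> (\<And>i. i \<in> I \<Longrightarrow> lo B i = lo C i) \<Longrightarrow> (\<And>i. i \<in> I \<Longrightarrow> hi B i = hi C i) \<Longrightarrow> B = C"
  by (metis box_eq half_open_box_cong)

lemma box_nonempty: "box B \<Longrightarrow> B \<noteq> {}"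
  unfolding box_def using half_open_box_nonempty_iff by blast

lemma mem_half_open_box:
  "x \<in> half_open_box n a b \<longleftrightarrow> x \<in> extensional I \<and> (\<forall>i\<in>I. a i \<le> x i \<and> x i < b i)"
  unfolding half_open_box_def PiE_def by auto

lemma mem_box: "box B \<Longrightarrow> x \<in> B \<longleftrightarrow> x \<in> extensional I \<and> (\<forall>i\<in>I. lo B i \<le> x i \<and> x i < hi B i)"
  using box_eq[of B] mem_half_open_box[of x "lo B" "hi B"] by simp

lemma box_X: "box X"
  unfolding unit_cube_def by (rule box_half_open_box) simp

lemma lo_X: "i \<in> I \<Longrightarrow> lo X i = 0" and hi_X: "i \<in> I \<Longrightarrow> hi X i = 1"
  unfolding unit_cube_def by (auto intro: lo_half_open_box hi_half_open_box)

lemma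
  assumes "box B"
  shows box_half: "box (half j e B)"
    and lo_half: "i \<in> I \<Longrightarrow>
      lo (half j e B) i = (if e \<and> i = j then (lo B j + hi B j) / 2 else lo B i)"
    and hi_half: "i \<in> I \<Longrightarrow>
      hi (half j e B) i = (if \<not> e \<and> i = j then (lo B j + hi B j) / 2 else hi B i)"
proof -
  let ?m = "(lo B j + hi B j) / 2"
  have 1: "((lo B)(j := ?m)) k < hi B k" "lo B k < ((hi B)(j := ?m)) k" if "k \<in> I" for k
    using lo_less_hi[OF assms that] by auto
  show "box (half j e B)"
    unfolding half_def using 1 by (auto simp del: fun_upd_apply intro: box_half_open_box)
  assume i: "i \<in> I"
  have "lo (half_open_box n ((lo B)(j := ?m)) (hi B)) i = ((lo B)(j := ?m)) i"
    "lo (half_open_box n (lo B) ((hi B)(j := ?m))) i = lo B i"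
    by (rule lo_half_open_box[OF _ i], fact 1)+
  then show "lo (half j e B) i = (if e \<and> i = j then ?m else lo B i)"
    unfolding half_def by (cases e; cases "i = j") simp_all
  have "hi (half_open_box n ((lo B)(j := ?m)) (hi B)) i = hi B i"
    "hi (half_open_box n (lo B) ((hi B)(j := ?m))) i = ((hi B)(j := ?m)) i"
    by (rule hi_half_open_box[OF _ i], fact 1)+
  then show "hi (half j e B) i = (if \<not> e \<and> i = j then ?m else hi B i)"
    unfolding half_def by (cases e; cases "i = j") simp_all
qed

lemma half_commute: "box B \<Longrightarrow> i \<noteq> j \<Longrightarrow> half i e (half j e' B) = half j e' (half i e B)"
  by (rule box_eqI) (auto simp: box_half lo_half hi_half)

text \<open>The midpoint belongs to the upper half, so inside \<open>B\<close> a single comparison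
  decides between the halves. That the halves partition \<open>B\<close> is read off from
  this.\<close>

lemma mem_half:
  assumes "box B" "j \<in> I"
  shows "x \<in> half j e B \<longleftrightarrow> x \<in> B \<and> ((lo B j + hi B j) / 2 \<le> x j \<longleftrightarrow> e)"
proof -
  \<comment> \<open>Coordinate \<open>j\<close> is isolated because halving leaves all other
    coordinates alone.\<close>
  have mem: "x \<in> C \<longleftrightarrow> x \<in> extensional I \<and> (lo C j \<le> x j \<and> x j < hi C j) \<and>
      (\<forall>i\<in>I - {j}. lo C i \<le> x i \<and> x i < hi C i)" if "box C" for C
    using that assms(2) by (auto simp: mem_box)
  have "lo B j < (lo B j + hi B j) / 2" "(lo B j + hi B j) / 2 < hi B j"
    using lo_less_hi[OF assms] by simp_all
  then show ?thesis
    unfolding mem[OF assms(1)] mem[OF box_half[OF assms(1)]]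
    using assms by (cases e) (auto simp: lo_half hi_half)
qed

lemma half_subset: "box B \<Longrightarrow> j \<in> I \<Longrightarrow> half j e B \<subseteq> B"
  by (auto simp: mem_half)

lemma half_Un: "box B \<Longrightarrow> j \<in> I \<Longrightarrow> half j False B \<union> half j True B = B"
  by (auto simp: mem_half)

lemma half_disjoint: "box B \<Longrightarrow> j \<in> I \<Longrightarrow> half j e B \<inter> half j (\<not> e) B = {}"
  by (auto simp: mem_half)

lemma half_neq: "box B \<Longrightarrow> j \<in> I \<Longrightarrow> half j False B \<noteq> half j True B"
  using half_disjoint[of B j False] box_nonempty[OF box_half] by auto

lemma half_psubset: "box B \<Longrightarrow> j \<in> I \<Longrightarrow> half j e B \<noteq> B"
  using half_disjoint[of B j e] box_nonempty[OF box_half] half_subset[of B j "\<not> e"] by fastforce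

section \<open>Affine maps between boxes\<close>

lemma aff_mem: 
  assumes "box B" "box C" "x \<in> B"
  shows "aff B C x \<in> C"
proof -
  have "lo C i \<le> lo C i + (hi C i - lo C i) / (hi B i - lo B i) * (x i - lo B i) \<and>
    lo C i + (hi C i - lo C i) / (hi B i - lo B i) * (x i - lo B i) < hi C i" if "i \<in> I" for i
  proof -
    have "0 \<le> (x i - lo B i) / (hi B i - lo B i)" "(x i - lo B i) / (hi B i - lo B i) < 1"
      using assms that lo_less_hi[OF assms(1) that] by (auto simp: mem_box)
    moreover have "hi C i - lo C i > 0" using lo_less_hi[OF assms(2) that] by simp
    ultimately have "0 \<le> (hi C i - lo C i) * ((x i - lo B i) / (hi B i - lo B i))"
      "(hi C i - lo C i) * ((x i - lo B i) / (hi B i - lo B i)) < (hi C i - lo C i) * 1"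
      by (simp_all only: mult_nonneg_nonneg less_imp_le mult_strict_left_mono)
    then show ?thesis by simp
  qed
  then show ?thesis using assms(2) by (simp add: mem_box aff_def)
qed

lemma aff_aff:
  assumes "box B" "box C" "box D"
  shows "aff C D (aff B C x) = aff B D x"
  using lo_less_hi[OF assms(1)] lo_less_hi[OF assms(2)]
  by (fastforce simp: aff_def fun_eq_iff restrict_def)

lemma aff_id:
  assumes "box B" "x \<in> B"
  shows "aff B B x = x"
proof
  fix i
  show "aff B B x i = x i"
  proof (cases "i \<in> I")
    case True
    with lo_less_hi[OF assms(1) True] show ?thesis by (simp add: aff_def)
  next
    case False
    with assms show ?thesis by (simp add: aff_def mem_box extensional_def)
  qed
qed

lemma aff_image:
  assumes "box B" "box C"
  shows "aff B C ` B = C"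
proof
  show "aff B C ` B \<subseteq> C" using aff_mem assms by blast
  show "C \<subseteq> aff B C ` B"
  proof
    fix y assume "y \<in> C"
    then have "y = aff B C (aff C B y)" "aff C B y \<in> B"
      using assms by (simp_all add: aff_aff aff_id aff_mem)
    then show "y \<in> aff B C ` B" by blast
  qed
qed

text \<open>Increasing affine maps send midpoints to midpoints, and halving both intervals keeps the
  slope. This is why an element stays affine on boxes when domain and range are cut in the same
  direction.\<close>

lemma aff_half:
  assumes "box B" "box C"
  shows "aff (half j e B) (half j e C) x = aff B C x"
proof
  fix i
  show "aff (half j e B) (half j e C) x i = aff B C x i"
  proof (cases "i \<in> I")
    case True
    then show ?thesis using assms lo_less_hi[OF assms(1) True] lo_less_hi[OF assms(2) True]
      by (cases e) (auto simp: aff_def lo_half hi_half field_simps)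
  qed (simp add: aff_def)
qed

lemma box_Int:
  assumes "box B" "box C" "B \<inter> C \<noteq> {}"
  shows "box (B \<inter> C)"
    and "i \<in> I \<Longrightarrow> lo (B \<inter> C) i = max (lo B i) (lo C i)"
    and "i \<in> I \<Longrightarrow> hi (B \<inter> C) i = min (hi B i) (hi C i)"
proof -
  let ?a = "\<lambda>i. max (lo B i) (lo C i)" and ?b = "\<lambda>i. min (hi B i) (hi C i)"
  have eq: "B \<inter> C = half_open_box n ?a ?b"
    using assms(1,2) by (auto simp: mem_box mem_half_open_box)
  then have "\<And>i. i \<in> I \<Longrightarrow> ?a i < ?b i"
    using assms(3) half_open_box_nonempty_iff by simp
  with eq show "box (B \<inter> C)" "i \<in> I \<Longrightarrow> lo (B \<inter> C) i = ?a i" "i \<in> I \<Longrightarrow> hi (B \<inter> C) i = ?b i"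
    by (auto simp: box_half_open_box lo_half_open_box hi_half_open_box)
qed

section \<open>Patterns\<close>

definition cut :: "nat \<Rightarrow> (nat \<Rightarrow> real) set \<Rightarrow> (nat \<Rightarrow> real) set set \<Rightarrow> (nat \<Rightarrow> real) set set" where
  "cut j B P = insert (half j False B) (insert (half j True B) (P - {B}))"

text \<open>Unlike in \<open>pattern\<close>, the starting box is a parameter, so that the
  subdivision of a single box of a pattern is an object of the same kind. Cuts are expressed through
  \<open>half\<close>, free of endpoint functions.\<close>

inductive pat :: "(nat \<Rightarrow> real) set \<Rightarrow> (nat \<Rightarrow> real) set set \<Rightarrow> bool" for B where
  pat_trivial: "pat B {B}"
| pat_cut: "pat B P \<Longrightarrow> C \<in> P \<Longrightarrow> j \<in> I \<Longrightarrow> pat B (cut j C P)"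

lemma pat_box: "pat B P \<Longrightarrow> box B \<Longrightarrow> C \<in> P \<Longrightarrow> box C"
  by (induction arbitrary: C rule: pat.induct) (auto simp: cut_def box_half)

lemma pat_finite: "pat B P \<Longrightarrow> finite P"
  by (induction rule: pat.induct) (auto simp: cut_def)

lemma pat_Union:
  assumes "pat B P" "box B"
  shows "\<Union>P = B"
  using assms
proof (induction rule: pat.induct)
  case (pat_cut P C j)
  have "\<Union> (cut j C P) = (half j False C \<union> half j True C) \<union> \<Union>(P - {C})"
    unfolding cut_def by blast
  also have "\<dots> = C \<union> \<Union>(P - {C})"
    using half_Un pat_cut pat_box by simp
  finally show ?case using pat_cut by blast
qed simp

lemma pat_subset: "pat B P \<Longrightarrow> box B \<Longrightarrow> C \<in> P \<Longrightarrow> C \<subseteq> B"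
  using pat_Union by blast

lemma pat_disjoint:
  assumes "pat B P" "box B" "C \<in> P" "D \<in> P" "x \<in> C" "x \<in> D"
  shows "C = D"
  using assms
proof (induction arbitrary: C D rule: pat.induct)
  case (pat_cut P A j)
  have A: "box A" using pat_cut pat_box by blast
  have h: "half j e A \<subseteq> A" "x \<notin> half j e A \<or> x \<notin> half j (\<not> e) A" for e
    using half_subset[OF A \<open>j \<in> I\<close>] half_disjoint[OF A \<open>j \<in> I\<close>] by blast+
  have "x \<notin> A" if "E \<in> P - {A}" "x \<in> E" for E
    using pat_cut.IH[of E A] that pat_cut by blast
  then have cases: "E = half j False A \<or> E = half j True A \<or> E \<in> P \<and> x \<notin> A"
    if "E \<in> cut j A P" "x \<in> E" for E
    using that unfolding cut_def by blast
  have sub: "x \<in> half j e A \<Longrightarrow> x \<in> A" for e using h(1) by blast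
  show ?case
    using cases[OF pat_cut.prems(2,4)] cases[OF pat_cut.prems(3,5)] h(2)[of True] sub[of False] sub[of True]
      pat_cut.prems pat_cut.IH[of C D] by (elim disjE) simp_all
qed simp

lemma pat_nonempty: "pat B P \<Longrightarrow> box B \<Longrightarrow> C \<in> P \<Longrightarrow> C \<noteq> {}"
  using pat_box box_nonempty by blast

lemma pat_Ball:
  "pat X P \<Longrightarrow> C \<in> P \<Longrightarrow> box C"
  "pat X P \<Longrightarrow> C \<in> P \<Longrightarrow> C \<subseteq> X"
  "pat X P \<Longrightarrow> C \<in> P \<Longrightarrow> C \<noteq> {}"
  using pat_box pat_subset pat_nonempty box_X by blast+

lemma pat_X_disjoint: "pat X P \<Longrightarrow> C \<in> P \<Longrightarrow> D \<in> P \<Longrightarrow> C \<noteq> D \<Longrightarrow> C \<inter> D = {}"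
  using pat_disjoint box_X by blast

lemma pat_cover: "pat X P \<Longrightarrow> x \<in> X \<Longrightarrow> \<exists>C\<in>P. x \<in> C"
  using pat_Union box_X by blast

text \<open>A half of \<open>B\<close> is nonempty, contained in \<open>B\<close> and different from
  it, so it would violate disjointness. Hence a cut really adds two new boxes and can be
  counted.\<close>

lemma half_notin_pat:
  assumes "pat X P" "B \<in> P" "j \<in> I"
  shows "half j e B \<notin> P"
proof
  assume "half j e B \<in> P"
  with pat_X_disjoint[OF assms(1) this assms(2)] show False
    using assms pat_Ball half_psubset half_subset box_half box_nonempty by (metis inf.absorb1)
qed

lemma half_in_cut: "half j e B \<in> cut j B P"
  unfolding cut_def by (cases e) auto

lemma in_cut_other: "C \<in> P \<Longrightarrow> C \<noteq> B \<Longrightarrow> C \<in> cut j B P"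
  unfolding cut_def by auto

lemma card_cut:
  assumes "pat X P" "B \<in> P" "j \<in> I"
  shows "card (cut j B P) = Suc (card P)"
proof -
  have "card (cut j B P) = Suc (Suc (card (P - {B})))"
    using half_notin_pat[OF assms] pat_finite[OF assms(1)] half_neq[of B j] pat_Ball[OF assms(1,2)] assms
    unfolding cut_def by simp
  then show ?thesis using card_Suc_Diff1[OF pat_finite[OF assms(1)] assms(2)] by simp
qed

lemma cut_commute:
  assumes "pat X P" "A \<in> P" "B \<in> P" "A \<noteq> B" "i \<in> I" "j \<in> I"
  shows "cut i A (cut j B P) = cut j B (cut i A P)"
  using half_notin_pat[OF assms(1,2,5)] half_notin_pat[OF assms(1,3,6)] assms(2,3,4)
  unfolding cut_def by (auto simp: insert_commute)

text \<open>The endpoint functions in \<open>pattern\<close> may differ from \<open>lo\<close> and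
  \<open>hi\<close> outside \<open>I\<close>, but \<open>half_open_box\<close> does not see the
  difference.\<close>

lemma pattern_iff: "pattern n P \<longleftrightarrow> pat X P"
proof
  assume "pattern n P"
  then show "pat X P"
  proof (induction rule: pattern.induct)
    case trivial
    show ?case by (rule pat_trivial)
  next
    case (divide P a b j)
    let ?B = "half_open_box n a b"
    have B: "box ?B" using pat_Ball(1) divide by blast
    then have ab: "i \<in> I \<Longrightarrow> a i < b i" for i
      using box_nonempty half_open_box_nonempty_iff by blast
    have "half j False ?B = half_open_box n a (b(j := (a j + b j) / 2))"
      "half j True ?B = half_open_box n (a(j := (a j + b j) / 2)) b"
      using divide(3) ab
      by (auto simp: half_def lo_half_open_box hi_half_open_box intro!: half_open_box_cong)
    with pat_cut[OF divide(4,2,3)] show ?case by (simp add: cut_def)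
  qed
next
  assume "pat X P"
  then show "pattern n P"
  proof (induction rule: pat.induct)
    case pat_trivial
    show ?case by (rule pattern.trivial)
  next
    case (pat_cut P C j)
    have "C = half_open_box n (lo C) (hi C)"
      using pat_cut pat_Ball(1) box_eq by blast
    with pattern.divide[of n P "lo C" "hi C" j] pat_cut show ?case
      by (simp add: cut_def half_def)
  qed
qed

subsection \<open>Dyadic boxes\<close>

text \<open>Each side is a standard dyadic interval, with \<open>k\<close> and \<open>m\<close>
  depending on the coordinate. Such intervals are nested or disjoint, which is what makes common
  refinements of patterns exist.\<close>

definition dyadic :: "(nat \<Rightarrow> real) set \<Rightarrow> bool" where
  "dyadic B \<longleftrightarrow> box B \<and> (\<forall>i\<in>I. \<exists>k m. lo B i = real k / 2 ^ m \<and> hi B i = (real k + 1) / 2 ^ m)"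

lemma dyadic_X: "dyadic X"
  unfolding dyadic_def by (auto simp: box_X lo_X hi_X intro!: exI[of _ 0])

lemma dyadic_half: 
  assumes "dyadic B"
  shows "dyadic (half j e B)"
  unfolding dyadic_def
proof (intro conjI ballI)
  have B: "box B" using assms dyadic_def by blast
  then show "box (half j e B)" by (rule box_half)
  fix i assume i: "i \<in> I"
  then obtain k m where km: "lo B i = real k / 2 ^ m" "hi B i = (real k + 1) / 2 ^ m"
    using assms dyadic_def by blast
  show "\<exists>k m. lo (half j e B) i = real k / 2 ^ m \<and> hi (half j e B) i = (real k + 1) / 2 ^ m"
  proof (cases "i = j")
    case True
    have "lo (half j e B) i = real (2 * k + of_bool e) / 2 ^ Suc m \<and>
      hi (half j e B) i = (real (2 * k + of_bool e) + 1) / 2 ^ Suc m"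
      using i km B True by (cases e) (simp_all add: lo_half hi_half field_simps)
    then show ?thesis by blast
  next
    case False
    with B i km show ?thesis by (auto simp: lo_half hi_half)
  qed
qed

lemma pat_dyadic: "pat B P \<Longrightarrow> dyadic B \<Longrightarrow> C \<in> P \<Longrightarrow> dyadic C"
  by (induction arbitrary: C rule: pat.induct) (auto simp: cut_def dyadic_half)

text \<open>Scaled by \<open>2 ^ m\<close>, the intervals become [k, k+1) and [l d, (l+1) d) with
  integer endpoints, and no integer lies strictly between k and k+1.\<close>

lemma dyadic_intervals_nested:
  fixes k l m p :: nat
  assumes "p \<le> m"
  shows "(real k + 1) / 2 ^ m \<le> real l / 2 ^ p \<or> (real l + 1) / 2 ^ p \<le> real k / 2 ^ m \<or>
    real l / 2 ^ p \<le> real k / 2 ^ m \<and> (real k + 1) / 2 ^ m \<le> (real l + 1) / 2 ^ p"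
proof -
  define d :: nat where "d = 2 ^ (m - p)"
  have scale: "x / 2 ^ p = x * real d / 2 ^ m" for x :: real
    using assms unfolding d_def by (simp add: field_simps flip: power_add)
  have "k + 1 \<le> l * d \<or> (l + 1) * d \<le> k \<or> l * d \<le> k \<and> k + 1 \<le> (l + 1) * d"
    by linarith
  then have "real (k + 1) \<le> real (l * d) \<or> real ((l + 1) * d) \<le> real k \<or>
    real (l * d) \<le> real k \<and> real (k + 1) \<le> real ((l + 1) * d)"
    by (simp only: of_nat_le_iff)
  then show ?thesis
    unfolding scale by (simp add: divide_le_cancel algebra_simps)
qed

text \<open>Either [u, v) is at least as long as [a, b) and nesting applies directly, or it is at
  most half as long and is compared with the lower half of [a, b), itself dyadic. Hence [u, v)
  crosses the midpoint only if it contains [a, b).\<close>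

lemma dyadic_interval_halves:
  fixes k l m p :: nat
  defines "a \<equiv> real k / 2 ^ m" and "b \<equiv> (real k + 1) / 2 ^ m"
    and "u \<equiv> real l / 2 ^ p" and "v \<equiv> (real l + 1) / 2 ^ p"
  shows "v \<le> a \<or> b \<le> u \<or> v \<le> (a + b) / 2 \<or> (a + b) / 2 \<le> u \<or> u \<le> a \<and> b \<le> v"
proof (cases "p \<le> m")
  case True
  from dyadic_intervals_nested[OF this, of k l] show ?thesis unfolding assms by blast
next
  case False
  have mid: "(real (2 * k) + 1) / 2 ^ Suc m = (a + b) / 2" "real (2 * k) / 2 ^ Suc m = a"
    unfolding a_def b_def by (simp_all add: field_simps)
  from False have "Suc m \<le> p" by simp
  from dyadic_intervals_nested[OF this, of l "2 * k", unfolded mid, folded u_def v_def]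
  show ?thesis by blast
qed

text \<open>What a cut of \<open>B\<close> looks like from \<open>C\<close>: if \<open>C\<close>
  meets both halves, then in direction \<open>j\<close> the side of \<open>C\<close> contains that
  of \<open>B\<close>. So \<open>B\<close> and \<open>B \<inter> C\<close> have the same midpoint
  there, and the piece is cut in its middle.\<close>

lemma dyadic_Int_half_cases:
  assumes "dyadic B" "dyadic C" "j \<in> I"
  obtains (empty) "B \<inter> C = {}"
  | (one) e where "half j e B \<inter> C = B \<inter> C" "half j (\<not> e) B \<inter> C = {}"
  | (both) "B \<inter> C \<noteq> {}" "box (B \<inter> C)" "\<And>e. half j e B \<inter> C = half j e (B \<inter> C)"
proof (cases "B \<inter> C = {}")
  case False
  have BC: "box B" "box C" using assms dyadic_def by auto
  note box = BC box_Int(1)[OF BC False]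
  note mems = mem_box[OF box(1)] mem_box[OF box(2)] mem_box[OF box(3)] mem_box[OF box_half]
  let ?a = "lo B j" and ?b = "hi B j" and ?u = "lo C j" and ?v = "hi C j"
  have bnd: "?a < ?v" "?u < ?b"
    using False assms(3) by (auto simp: mems) (meson le_less_trans)+
  obtain k m where "?a = real k / 2 ^ m" "?b = (real k + 1) / 2 ^ m"
    using assms dyadic_def by blast
  moreover obtain l p where "?u = real l / 2 ^ p" "?v = (real l + 1) / 2 ^ p"
    using assms dyadic_def by blast
  ultimately consider "?v \<le> (?a + ?b) / 2" | "(?a + ?b) / 2 \<le> ?u" | "?u \<le> ?a" "?b \<le> ?v"
    using dyadic_interval_halves[of l p k m] bnd by (metis not_le)
  then show thesis
  proof cases
    case 1
    then have "half j True B \<inter> C = {}"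
      using box assms(3) by (fastforce simp: mems lo_half hi_half)
    with half_Un[OF box(1) assms(3)] one[of False] show thesis by auto
  next
    case 2
    then have "half j False B \<inter> C = {}"
      using box assms(3) by (fastforce simp: mems lo_half hi_half)
    with half_Un[OF box(1) assms(3)] one[of True] show thesis by auto
  next
    case 3
    have lo: "lo (B \<inter> C) j = ?a" "hi (B \<inter> C) j = ?b"
      using 3 box_Int[OF box(1,2) False] assms(3) by auto
    have "half j e B \<inter> C = half j e (B \<inter> C)" for e
      using mem_half[OF box(1) assms(3)] mem_half[OF box(3) assms(3)] lo by auto
    with False box show thesis using both by blast
  qed
qed (rule empty)

definition trace :: "(nat \<Rightarrow> real) set set \<Rightarrow> (nat \<Rightarrow> real) set \<Rightarrow> (nat \<Rightarrow> real) set set" where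
  "trace R B = (\<lambda>C. C \<inter> B) ` R - {{}}"

text \<open>Replays the construction of \<open>R\<close> inside \<open>B\<close>: by the three cases
  above, a cut of a box \<open>C\<close> either leaves the trace unchanged or cuts the piece
  \<open>C \<inter> B\<close> in the same direction.\<close>

lemma pat_trace:
  assumes "pat A R" "dyadic A" "dyadic B" "B \<subseteq> A"
  shows "pat B (trace R B)"
  using assms
proof (induction rule: pat.induct)
  case pat_trivial
  then have "A \<inter> B = B" "B \<noteq> {}" using box_nonempty dyadic_def by auto
  then have "trace {A} B = {B}" by (simp add: trace_def)
  then show ?case using pat.pat_trivial by simp
next
  case (pat_cut R C j)
  have A: "box A" and C: "dyadic C" "box C"
    using pat_cut pat_dyadic dyadic_def by blast+
  have IH: "pat B (trace R B)" using pat_cut by blast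
  have trace_cut: "trace (cut j C R) B =
      {half j False C \<inter> B, half j True C \<inter> B} \<union> (\<lambda>C. C \<inter> B) ` (R - {C}) - {{}}"
    unfolding trace_def cut_def by blast
  have trace: "trace R B = {C \<inter> B} \<union> (\<lambda>C. C \<inter> B) ` (R - {C}) - {{}}"
    unfolding trace_def using pat_cut(2) by blast
  from C(1) pat_cut.prems(2) pat_cut.hyps(3) show ?case
  proof (cases rule: dyadic_Int_half_cases)
    case empty
    then have "half j e C \<inter> B = {}" for e
      using half_subset[OF C(2) pat_cut.hyps(3), of e] by blast
    then have "trace (cut j C R) B = trace R B" using empty unfolding trace_cut trace by simp
    then show ?thesis using IH by simp
  next
    case (one e)
    then have "trace (cut j C R) B = trace R B"
      unfolding trace_cut trace by (cases e) auto
    then show ?thesis using IH by simp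
  next
    case both
    \<comment> \<open>A nonempty piece determines the box it comes from, so removing the piece of
      \<open>C\<close> removes nothing else.\<close>
    have "D \<inter> B \<noteq> C \<inter> B" if "D \<in> R - {C}" for D
      using that both(1) pat_disjoint[OF pat_cut(1) A] pat_cut(2) by blast
    then have "trace R B - {C \<inter> B} = (\<lambda>C. C \<inter> B) ` (R - {C}) - {{}}"
      unfolding trace by auto
    moreover have "half j e (C \<inter> B) \<noteq> {}" for e
      using box_half[OF both(2)] box_nonempty by blast
    ultimately have "trace (cut j C R) B = cut j (C \<inter> B) (trace R B)"
      unfolding trace_cut both(3) by (simp add: cut_def insert_Diff_if)
    moreover have "C \<inter> B \<in> trace R B" using both(1) trace by blast
    ultimately show ?thesis using pat.pat_cut[OF IH] pat_cut.hyps(3) by simp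
  qed
qed

section \<open>Elements carrying one pattern to another\<close>

text \<open>
  In terms of numbered patterns, a domain \<open>P\<close> has the range \<open>map (image f) P\<close>, so that the
  numbering can be dropped.
\<close>

definition carries :: "((nat \<Rightarrow> real) \<Rightarrow> nat \<Rightarrow> real) \<Rightarrow> (nat \<Rightarrow> real) set set \<Rightarrow> (nat \<Rightarrow> real) set set \<Rightarrow> bool" where
  "carries f P Q \<longleftrightarrow> f \<in> Bij X \<and> pat X P \<and> pat X Q \<and> Q = image f ` P \<and>
     (\<forall>B\<in>P. \<forall>x\<in>B. f x = aff B (f ` B) x)"

lemma carriesI:
  assumes "f \<in> Bij X" "pat X P" "pat X Q" "image f ` P = Q"
    "\<And>B x. B \<in> P \<Longrightarrow> x \<in> B \<Longrightarrow> f x = aff B (f ` B) x"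
  shows "carries f P Q"
  using assms unfolding carries_def by blast

lemma Bij_inj: "f \<in> Bij X \<Longrightarrow> inj_on f X"
  by (simp add: Bij_def bij_betw_def)

lemma Bij_image: "f \<in> Bij X \<Longrightarrow> f ` X = X"
  by (simp add: Bij_def bij_betw_def)

lemma Bij_image_eq_iff: "f \<in> Bij X \<Longrightarrow> A \<subseteq> X \<Longrightarrow> B \<subseteq> X \<Longrightarrow> f ` A = f ` B \<longleftrightarrow> A = B"
  by (rule inj_on_image_eq_iff[OF Bij_inj])

lemma carriesD:
  assumes "carries f P Q"
  shows "f \<in> Bij X" "pat X P" "pat X Q" "image f ` P = Q"
    "B \<in> P \<Longrightarrow> f ` B \<in> Q" "B \<in> P \<Longrightarrow> x \<in> B \<Longrightarrow> f x = aff B (f ` B) x"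
    "B \<in> P \<Longrightarrow> box (f ` B)" "B \<in> P \<Longrightarrow> f ` B \<subseteq> X"
  using assms pat_Ball(1,2) unfolding carries_def by blast+

lemma carries_bij_betw:
  assumes "carries f P Q"
  shows "bij_betw (image f) P Q"
  unfolding bij_betw_def
proof
  show "inj_on (image f) P"
  proof (rule inj_onI)
    fix C D assume "C \<in> P" "D \<in> P" "f ` C = f ` D"
    then show "C = D"
      using Bij_image_eq_iff[OF carriesD(1)[OF assms], of C D] pat_Ball(2)[OF carriesD(2)[OF assms]]
      by simp
  qed
qed (rule carriesD(4)[OF assms])

lemma carries_id:
  assumes P: "pat X P"
  shows "carries (\<lambda>x\<in>X. x) P P"
proof (rule carriesI[OF id_Bij P P])
  have im: "(\<lambda>x\<in>X. x) ` B = B" if "B \<in> P" for B using pat_Ball(2)[OF P that] by auto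
  have "image (\<lambda>x\<in>X. x) ` P = (\<lambda>B. B) ` P" by (rule image_cong[OF refl im])
  then show "image (\<lambda>x\<in>X. x) ` P = P" by (simp only: image_ident)
  fix B x assume B: "B \<in> P" "x \<in> B"
  then have "x \<in> X" using pat_Ball(2)[OF P] by blast
  then show "(\<lambda>x\<in>X. x) x = aff B ((\<lambda>x\<in>X. x) ` B) x"
    unfolding im[OF B(1)] using aff_id[OF pat_Ball(1)[OF P B(1)] B(2)] by simp
qed

lemma carries_unique:
  assumes "carries f P Q" "carries g P R" "\<And>B. B \<in> P \<Longrightarrow> f ` B = g ` B"
  shows "f = g"
proof (rule extensionalityI[of _ X])
  show "f \<in> extensional X" "g \<in> extensional X"
    using assms(1,2)[THEN carriesD(1)] by (auto dest: Bij_imp_extensional)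
  fix x assume "x \<in> X"
  then obtain B where B: "B \<in> P" "x \<in> B" using pat_cover[OF carriesD(2)[OF assms(1)]] by blast
  then show "f x = g x"
    using carriesD(6)[OF assms(1) B] carriesD(6)[OF assms(2) B] assms(3) by simp
qed

lemma carries_compose:
  assumes "carries f P Q" "carries g Q R"
  shows "carries (compose X g f) P R"
proof (rule carriesI)
  have im: "compose X g f ` B = g ` f ` B" if "B \<in> P" for B
    using pat_Ball(2)[OF carriesD(2)[OF assms(1)] that] by (auto simp: compose_def image_def)
  show "compose X g f \<in> Bij X" using assms[THEN carriesD(1)] compose_Bij by blast
  show "pat X P" "pat X R" by (fact carriesD(2)[OF assms(1)], fact carriesD(3)[OF assms(2)])
  have "image (compose X g f) ` P = image g ` image f ` P"
    using im by (simp add: image_image)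
  then show "image (compose X g f) ` P = R"
    using carriesD(4)[OF assms(1)] carriesD(4)[OF assms(2)] by simp
  fix B x assume B: "B \<in> P" "x \<in> B"
  note f = carriesD[OF assms(1)] and g = carriesD[OF assms(2)]
  have x: "x \<in> X" "box B" "f x \<in> f ` B" using pat_Ball(1,2)[OF f(2) B(1)] B(2) by auto
  have "g (f x) = aff (f ` B) (g ` f ` B) (aff B (f ` B) x)"
    using g(6)[OF f(5)[OF B(1)] x(3)] f(6)[OF B] by simp
  also have "\<dots> = aff B (g ` f ` B) x"
    by (rule aff_aff[OF x(2) f(7)[OF B(1)] g(7)[OF f(5)[OF B(1)]]])
  finally show "compose X g f x = aff B (compose X g f ` B) x"
    using im[OF B(1)] x(1) by (simp add: compose_eq)
qed

lemma carries_inv: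
  assumes "carries f P Q"
  shows "carries (\<lambda>x\<in>X. inv_into X f x) Q P"
proof -
  let ?g = "\<lambda>x\<in>X. inv_into X f x"
  note f = carriesD[OF assms]
  have inj: "inj_on f X" by (rule Bij_inj[OF f(1)])
  have im: "?g ` f ` B = B" if "B \<in> P" for B
  proof -
    have "f ` B \<subseteq> X" "B \<subseteq> X" using that f(2,3,5) pat_Ball(2) by blast+
    then have "?g ` f ` B = inv_into X f ` f ` B" by (intro image_cong) auto
    then show ?thesis using inv_into_image_cancel[OF inj \<open>B \<subseteq> X\<close>] by simp
  qed
  have "image ?g ` Q = (\<lambda>B. ?g ` f ` B) ` P" unfolding f(4)[symmetric] by (simp only: image_image)
  also have "\<dots> = P" using im by simp
  finally have imP: "image ?g ` Q = P" .
  have "?g y = aff C (?g ` C) y" if C: "C \<in> Q" "y \<in> C" for C y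
  proof -
    obtain B where B: "B \<in> P" "C = f ` B" using C(1) f(4) by blast
    obtain x where x: "x \<in> B" "y = f x" using C(2) B by blast
    have "x \<in> X" "y \<in> X" "box B" "box C" 
      using pat_Ball[OF f(2) B(1)] pat_Ball[OF f(3) C(1)] C(2) x(1) by auto
    then have "?g y = x" using x inj by simp
    moreover have "aff C B y = x"
      using x f(6)[OF B(1) x(1)] B \<open>box B\<close> \<open>box C\<close> by (simp add: aff_aff aff_id)
    ultimately show ?thesis using im[OF B(1)] B by simp
  qed
  then show ?thesis by (intro carriesI restrict_inv_into_Bij f(1-3) imP)
qed

lemma carries_cut:
  assumes "carries f P Q" "B \<in> P" "j \<in> I"
  shows "carries f (cut j B P) (cut j (f ` B) Q)"
    and "f ` half j e B = half j e (f ` B)"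
proof -
  note f = carriesD[OF assms(1)]
  have B: "box B" "box (f ` B)" "B \<subseteq> X" using f(2,7) assms(2) pat_Ball by blast+
  have on_half: "f x = aff (half j e B) (half j e (f ` B)) x" if "x \<in> half j e B" for x e
    using that f(6)[OF assms(2), of x] half_subset[OF B(1) assms(3), of e]
      aff_half[OF B(1,2), of j e x] by auto
  have im: "f ` half j e B = half j e (f ` B)" for e
  proof -
    have "f ` half j e B = aff (half j e B) (half j e (f ` B)) ` half j e B"
      using on_half by (intro image_cong) auto
    then show ?thesis using aff_image box_half B by simp
  qed
  then show "f ` half j e B = half j e (f ` B)" .
  have "image f ` (P - {B}) = image f ` P - image f ` {B}"
    by (rule inj_on_image_set_diff[OF bij_betw_imp_inj_on[OF carries_bij_betw[OF assms(1)]]]) (use assms in auto)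
  then have "image f ` cut j B P = cut j (f ` B) Q"
    unfolding cut_def using im f(4) by simp
  moreover have "f x = aff C (f ` C) x" if "C \<in> cut j B P" "x \<in> C" for C x
  proof (cases "C \<in> P")
    case True
    then show ?thesis using f(6) that by blast
  next
    case False
    then obtain e where "C = half j e B" using \<open>C \<in> cut j B P\<close> unfolding cut_def by blast
    then show ?thesis using on_half[of x e] im[of e] that by simp
  qed
  ultimately show "carries f (cut j B P) (cut j (f ` B) Q)"
    using f(1) pat_cut[OF f(2) assms(2,3)] pat_cut[OF f(3) f(5)[OF assms(2)] assms(3)]
    by (intro carriesI)
qed

section \<open>Refining the patterns of an element\<close>

lemma carries_cut_image:
  "carries f P (image f ` P) \<Longrightarrow> B \<in> P \<Longrightarrow> j \<in> I \<Longrightarrow> carries f (cut j B P) (image f ` cut j B P)"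
  using carries_cut(1)[of f P "image f ` P" B j] carriesD(4)[OF carries_cut(1)[of f P "image f ` P" B j]]
  by simp

text \<open>Follows the cuts of \<open>R\<close> one by one; each box that is cut lies in
  \<open>B\<close> and hence differs from the other boxes of \<open>P\<close>. The range is written
  as the image of the domain so that the induction need not name the ranges.\<close>

lemma carries_substitute:
  assumes "pat B R" "carries f P (image f ` P)" "B \<in> P"
  shows "carries f (P - {B} \<union> R) (image f ` (P - {B} \<union> R))"
  using assms
proof (induction rule: pat.induct)
  case pat_trivial
  then have "P - {B} \<union> {B} = P" by blast
  then show ?case using pat_trivial by simp
next
  case (pat_cut R C j)
  have P: "pat X P" using pat_cut.prems(1) by (rule carriesD(2))
  have "C \<subseteq> B" "C \<noteq> {}"
    using pat_cut.hyps pat_cut.prems(2) P pat_Ball(1) pat_subset pat_nonempty by blast+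
  then have "C \<notin> P - {B}" using pat_X_disjoint[OF P _ pat_cut.prems(2)] by blast
  then have "P - {B} \<union> cut j C R = cut j C (P - {B} \<union> R)"
    unfolding cut_def by blast
  then show ?case using carries_cut_image pat_cut by simp
qed

text \<open>Boxes are replaced one at a time, \<open>A\<close> being the set of those already
  refined. A further box \<open>C\<close> is not among the new pieces, since these lie in boxes
  disjoint from \<open>C\<close>, so it can be substituted next.\<close>

lemma carries_refine:
  assumes "carries f P Q" "\<And>B. B \<in> P \<Longrightarrow> pat B (F B)"
  shows "carries f (\<Union>B\<in>P. F B) (image f ` (\<Union>B\<in>P. F B))"
proof -
  note P = carriesD(2)[OF assms(1)]
  have "carries f ((P - A) \<union> (\<Union>B\<in>A. F B)) (image f ` ((P - A) \<union> (\<Union>B\<in>A. F B)))"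
    if "finite A" "A \<subseteq> P" for A
    using that
  proof (induction rule: finite_induct)
    case empty
    then show ?case using assms(1) carriesD(4) by simp
  next
    case (insert C A)
    let ?P = "(P - A) \<union> (\<Union>B\<in>A. F B)"
    have "C \<notin> F B" if "B \<in> A" for B
    proof
      assume "C \<in> F B"
      moreover have "B \<in> P" "C \<in> P" "B \<noteq> C" using insert that by auto
      ultimately show False
        using pat_subset[OF assms(2)[of B] pat_Ball(1)[OF P]] pat_Ball(3)[OF P]
          pat_X_disjoint[OF P, of B C] by blast
    qed
    then have "(P - insert C A) \<union> (\<Union>B\<in>insert C A. F B) = ?P - {C} \<union> F C" by auto
    moreover have "carries f (?P - {C} \<union> F C) (image f ` (?P - {C} \<union> F C))"
      by (rule carries_substitute) (use insert assms(2) in auto)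
    ultimately show ?case by (simp only:)
  qed
  from this[of P] show ?thesis using pat_finite[OF P] by simp
qed

text \<open>Taking the identity as the element turns refinement of an element into refinement of a
  pattern.\<close>

lemma pat_refine: "pat X P \<Longrightarrow> (\<And>B. B \<in> P \<Longrightarrow> pat B (F B)) \<Longrightarrow> pat X (\<Union>B\<in>P. F B)"
  by (rule carriesD(2)[OF carries_refine[OF carries_id]])

lemma pat_substitute: "pat X P \<Longrightarrow> B \<in> P \<Longrightarrow> pat B R \<Longrightarrow> pat X (P - {B} \<union> R)"
  using carriesD(2)[OF carries_substitute[of B R "\<lambda>x\<in>X. x" P]] carriesD(4)[OF carries_id[of P]]
    carries_id[of P] by simp

section \<open>Common refinements\<close>

definition meet :: "(nat \<Rightarrow> real) set set \<Rightarrow> (nat \<Rightarrow> real) set set \<Rightarrow> (nat \<Rightarrow> real) set set" where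
  "meet P Q = (\<lambda>(B, C). B \<inter> C) ` (P \<times> Q) - {{}}"

lemma meet_commute: "meet P Q = meet Q P"
  unfolding meet_def by (auto simp: image_def)

lemma pat_X_trace: "pat X P \<Longrightarrow> pat X Q \<Longrightarrow> B \<in> P \<Longrightarrow> pat B (trace Q B)"
  using pat_trace[of X Q B] pat_dyadic dyadic_X pat_Ball(2) by blast

lemma meet_eq_Union_trace: "meet P Q = (\<Union>B\<in>P. trace Q B)"
  unfolding meet_def trace_def by auto

lemma carries_meet:
  "carries f P Q \<Longrightarrow> pat X R \<Longrightarrow> carries f (meet P R) (image f ` meet P R)"
  unfolding meet_eq_Union_trace by (rule carries_refine) (auto simp: pat_X_trace dest: carriesD)

text \<open>Refining the range of \<open>f\<close> is refining the domain of its inverse. Inverting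
  twice returns \<open>f\<close> itself, because all maps involved are extensional bijections of the
  cube.\<close>

lemma carries_meet_range:
  assumes "carries f P Q" "pat X R"
  obtains P' where "carries f P' (meet Q R)"
proof -
  let ?g = "\<lambda>x\<in>X. inv_into X f x"
  let ?h = "\<lambda>x\<in>X. inv_into X ?g x"
  have "carries ?g (meet Q R) (image ?g ` meet Q R)"
    by (rule carries_meet[OF carries_inv[OF assms(1)] assms(2)])
  note carries_inv[OF this]
  moreover have "?h = f"
  proof (rule extensionalityI[of _ X])
    fix x assume x: "x \<in> X"
    note f = carriesD(1)[OF assms(1)]
    have g: "?g \<in> Bij X" by (rule restrict_inv_into_Bij[OF f])
    have fx: "f x \<in> X" using x Bij_image[OF f] by blast
    then have "?g (f x) = x" using x Bij_inj[OF f] by simp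
    then show "?h x = f x" using fx x Bij_inj[OF g] inv_into_f_f[of ?g X "f x"] by simp
  qed (use carriesD(1)[OF assms(1)] Bij_imp_extensional in auto)
  ultimately show thesis using that by simp
qed

text \<open>Glues the affine maps from \<open>B\<close> to \<open>\<sigma> B\<close>. Points with
  equal images lie in one box of \<open>Q\<close>, hence in one box of \<open>P\<close> because
  \<open>\<sigma>\<close> is injective, and there the affine map has an inverse.\<close>

lemma carries_exists:
  assumes P: "pat X P" and Q: "pat X Q" and \<sigma>: "bij_betw \<sigma> P Q"
  obtains f where "carries f P Q" "\<And>B. B \<in> P \<Longrightarrow> f ` B = \<sigma> B"
proof -
  define K where "K x = (THE B. B \<in> P \<and> x \<in> B)" for x
  have K: "K x = B" if "B \<in> P" "x \<in> B" for x B
    unfolding K_def using that pat_X_disjoint[OF P] by (intro the_equality) blast+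
  define f where "f = (\<lambda>x\<in>X. aff (K x) (\<sigma> (K x)) x)"
  have f: "f x = aff B (\<sigma> B) x" if "B \<in> P" "x \<in> B" for x B
    using that K pat_Ball(2)[OF P] unfolding f_def by auto
  have \<sigma>Q: "\<sigma> B \<in> Q" "box B" "box (\<sigma> B)" if "B \<in> P" for B
    using that \<sigma> pat_Ball(1)[OF P] pat_Ball(1)[OF Q] bij_betwE by blast+
  have im: "f ` B = \<sigma> B" if "B \<in> P" for B
  proof -
    have "f ` B = aff B (\<sigma> B) ` B" using f that by (intro image_cong) auto
    then show ?thesis using aff_image \<sigma>Q that by simp
  qed
  have imP: "image f ` P = Q" using im \<sigma> by (simp add: bij_betw_def)
  have "inj_on f X"
  proof (rule inj_onI)
    fix x y assume xy: "x \<in> X" "y \<in> X" "f x = f y"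
    obtain B where B: "B \<in> P" "x \<in> B" using pat_cover[OF P] xy by blast
    obtain C where C: "C \<in> P" "y \<in> C" using pat_cover[OF P] xy by blast
    have "f x \<in> \<sigma> B" using im[OF B(1)] B(2) by blast
    moreover have "f x \<in> \<sigma> C" using im[OF C(1)] C(2) xy(3) by auto
    ultimately have "\<sigma> B = \<sigma> C"
      using pat_X_disjoint[OF Q \<sigma>Q(1)[OF B(1)] \<sigma>Q(1)[OF C(1)]] by blast
    then have y: "y \<in> B" using bij_betw_imp_inj_on[OF \<sigma>] B(1) C inj_onD by metis
    have "aff B (\<sigma> B) x = aff B (\<sigma> B) y"
      using f[OF B] f[OF B(1) y] xy(3) by (simp only:)
    then have "aff (\<sigma> B) B (aff B (\<sigma> B) x) = aff (\<sigma> B) B (aff B (\<sigma> B) y)" by (rule arg_cong)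
    then show "x = y" using \<sigma>Q[OF B(1)] B(2) y by (simp add: aff_aff aff_id)
  qed
  moreover have "f ` X = X"
  proof -
    have "f ` X = \<Union>(image f ` P)" using pat_Union[OF P box_X] by (simp add: image_Union[symmetric])
    then show ?thesis using imP pat_Union[OF Q box_X] by simp
  qed
  moreover have "f \<in> extensional X" by (simp add: f_def)
  ultimately have "f \<in> Bij X" by (simp add: Bij_def bij_betw_def)
  moreover have "f x = aff B (f ` B) x" if "B \<in> P" "x \<in> B" for B x
    using f[OF that] im[OF that(1)] by (simp only:)
  ultimately have "carries f P Q"
    using P Q imP by (intro carriesI)
  then show thesis by (rule that) (rule im)
qed

section \<open>The group\<close>

text \<open>Both boxes are nonempty, so the endpoints quantified in \<open>affine_on_box\<close> are
  forced at all coordinates and agree there with \<open>lo\<close> and \<open>hi\<close>.\<close>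

lemma affine_on_box_iff:
  assumes "box B" "box C"
  shows "affine_on_box n B C f \<longleftrightarrow> (\<forall>x\<in>B. f x = aff B C x)"
proof
  assume "affine_on_box n B C f"
  then obtain a b a' b' where eq: "B = half_open_box n a b" "C = half_open_box n a' b'"
    and f: "\<And>x. x \<in> B \<Longrightarrow> f x = (\<lambda>i\<in>I. a' i + (b' i - a' i) / (b i - a i) * (x i - a i))"
    unfolding affine_on_box_def by blast
  have "\<And>i. i \<in> I \<Longrightarrow> a i < b i" "\<And>i. i \<in> I \<Longrightarrow> a' i < b' i"
    using box_nonempty[OF assms(1)] box_nonempty[OF assms(2)] half_open_box_nonempty_iff
    unfolding eq by blast+
  then have "(\<lambda>i\<in>I. a' i + (b' i - a' i) / (b i - a i) * (x i - a i)) = aff B C x" for x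
    unfolding aff_def eq
    by (intro restrict_ext) (simp add: lo_half_open_box hi_half_open_box)
  with f show "\<forall>x\<in>B. f x = aff B C x" by simp
next
  assume "\<forall>x\<in>B. f x = aff B C x"
  then show "affine_on_box n B C f"
    unfolding affine_on_box_def aff_def using box_eq[OF assms(1)] box_eq[OF assms(2)] by blast
qed

lemma determines_iff:
  "determines n P Q f \<longleftrightarrow> distinct P \<and> Q = map (image f) P \<and> carries f (set P) (set Q)"
proof
  assume "determines n P Q f"
  then have P: "distinct P" "pat X (set P)" and Q: "pat X (set Q)" and len: "length P = length Q"
    and f: "f \<in> Bij X" and aff: "\<And>m. m < length P \<Longrightarrow> affine_on_box n (P ! m) (Q ! m) f"
    unfolding determines_def numbered_pattern_def pattern_iff by auto
  have on: "\<forall>x\<in>P ! m. f x = aff (P ! m) (Q ! m) x" "f ` (P ! m) = Q ! m" if "m < length P" for m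
  proof -
    have B: "box (P ! m)" "box (Q ! m)"
      using pat_Ball(1)[OF P(2)] pat_Ball(1)[OF Q] that len by simp_all
    show a: "\<forall>x\<in>P ! m. f x = aff (P ! m) (Q ! m) x" using aff[OF that] affine_on_box_iff[OF B] by simp
    then have "f ` (P ! m) = aff (P ! m) (Q ! m) ` (P ! m)" by (intro image_cong) auto
    then show "f ` (P ! m) = Q ! m" using aff_image[OF B] by simp
  qed
  have map: "Q = map (image f) P" by (rule nth_equalityI) (simp_all add: len on(2))
  have "f x = aff B (f ` B) x" if B: "B \<in> set P" "x \<in> B" for B x
  proof -
    obtain m where m: "m < length P" "B = P ! m" using B(1) by (auto simp: in_set_conv_nth)
    then show ?thesis using on(1)[OF m(1)] on(2)[OF m(1)] B(2) by simp
  qed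
  moreover have "image f ` set P = set Q" unfolding map by simp
  ultimately show "distinct P \<and> Q = map (image f) P \<and> carries f (set P) (set Q)"
    using P f Q map by (intro conjI carriesI) simp_all
next
  assume *: "distinct P \<and> Q = map (image f) P \<and> carries f (set P) (set Q)"
  then have c: "carries f (set P) (set Q)" and Q: "Q = map (image f) P" and d: "distinct P" by auto
  have "distinct Q"
    using bij_betw_imp_inj_on[OF carries_bij_betw[OF c]] d Q by (simp add: distinct_map)
  moreover have "affine_on_box n (P ! m) (Q ! m) f" if "m < length P" for m
  proof -
    have m: "P ! m \<in> set P" using that by simp
    have "affine_on_box n (P ! m) (f ` (P ! m)) f"
      using affine_on_box_iff[OF pat_Ball(1)[OF carriesD(2)[OF c] m] carriesD(7)[OF c m]]
        carriesD(6)[OF c m] by blast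
    then show ?thesis using Q that by simp
  qed
  ultimately show "determines n P Q f"
    unfolding determines_def numbered_pattern_def pattern_iff
    using d Q carriesD(1-3)[OF c] by simp
qed

lemma carrier_nV: "carrier (nV n) = {f. \<exists>P Q. carries f P Q}"
proof -
  have "\<exists>P Q. determines n P Q f" if c: "carries f P Q" for f P Q
  proof -
    obtain xs where "set xs = P" "distinct xs"
      using finite_distinct_list[OF pat_finite[OF carriesD(2)[OF c]]] by blast
    then have "determines n xs (map (image f) xs) f"
      using c carriesD(4)[OF c] unfolding determines_iff by simp
    then show ?thesis by blast
  qed
  then show ?thesis unfolding nV_def by (auto simp: determines_iff)
qed

lemma carries_carrier: "carries f P Q \<Longrightarrow> f \<in> carrier (nV n)"
  unfolding carrier_nV by blast

lemma nV_Bij: "f \<in> carrier (nV n) \<Longrightarrow> f \<in> Bij X"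
  unfolding carrier_nV by (auto dest: carriesD)

lemma mult_nV:
  "f \<in> carrier (nV n) \<Longrightarrow> g \<in> carrier (nV n) \<Longrightarrow> g \<otimes>\<^bsub>nV n\<^esub> f = compose X g f"
  using nV_Bij[of f] nV_Bij[of g] by (simp add: nV_def BijGroup_def)

lemma one_nV: "\<one>\<^bsub>nV n\<^esub> = (\<lambda>x\<in>X. x)"
  by (simp add: nV_def BijGroup_def)

lemma carries_mult:
  assumes "carries f P Q" "carries g Q R"
  shows "carries (g \<otimes>\<^bsub>nV n\<^esub> f) P R"
  using carries_compose[OF assms] mult_nV carries_carrier assms by simp

text \<open>To compose, the range of \<open>f\<close> must be the domain of \<open>g\<close>. The
  common refinement of \<open>Q\<close> and \<open>R\<close> is pulled back along \<open>f\<close>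
  and pushed forward along \<open>g\<close>.\<close>

lemma carries_common:
  assumes "carries f P Q" "carries g R S"
  obtains P' Q' S' where "carries f P' Q'" "carries g Q' S'"
proof -
  obtain P' where "carries f P' (meet Q R)"
    using carries_meet_range[OF assms(1) carriesD(2)[OF assms(2)]] .
  moreover have "carries g (meet Q R) (image g ` meet Q R)"
    using carries_meet[OF assms(2) carriesD(3)[OF assms(1)]] by (simp add: meet_commute)
  ultimately show thesis using that by blast
qed

lemma subgroup_nV: "subgroup (carrier (nV n)) (BijGroup X)"
proof
  show "carrier (nV n) \<subseteq> carrier (BijGroup X)" using nV_Bij by (auto simp: BijGroup_def)
  show "\<one>\<^bsub>BijGroup X\<^esub> \<in> carrier (nV n)"
    using carries_carrier[OF carries_id[OF pat_trivial]] by (simp add: BijGroup_def)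
next
  fix g f assume gf: "g \<in> carrier (nV n)" "f \<in> carrier (nV n)"
  then obtain P Q R S where fg: "carries f P Q" "carries g R S" unfolding carrier_nV by blast
  then obtain P' Q' S' where "carries f P' Q'" "carries g Q' S'" by (rule carries_common)
  from carries_carrier[OF carries_compose[OF this]] show "g \<otimes>\<^bsub>BijGroup X\<^esub> f \<in> carrier (nV n)"
    using gf nV_Bij by (simp add: BijGroup_def)
next
  fix f assume f: "f \<in> carrier (nV n)"
  then obtain P Q where "carries f P Q" unfolding carrier_nV by blast
  from carries_carrier[OF carries_inv[OF this]] show "inv\<^bsub>BijGroup X\<^esub> f \<in> carrier (nV n)"
    using inv_BijGroup[OF nV_Bij[OF f]] by simp
qed

sublocale group "nV n"
proof -
  have "nV n = BijGroup X\<lparr>carrier := carrier (nV n)\<rparr>" by (simp add: nV_def)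
  then show "group (nV n)" using subgroup.subgroup_is_group[OF subgroup_nV group_BijGroup] by simp
qed

abbreviation mul (infixl \<open>\<bullet>\<close> 70) where "f \<bullet> g \<equiv> f \<otimes>\<^bsub>nV n\<^esub> g"
abbreviation ginv where "ginv f \<equiv> inv\<^bsub>nV n\<^esub> f"

lemma ginv_eq: "f \<in> carrier (nV n) \<Longrightarrow> ginv f = (\<lambda>x\<in>X. inv_into X f x)"
proof -
  have "nV n = BijGroup X\<lparr>carrier := carrier (nV n)\<rparr>" by (simp add: nV_def)
  moreover assume "f \<in> carrier (nV n)"
  ultimately show ?thesis
    using group.m_inv_consistent[OF group_BijGroup subgroup_nV] inv_BijGroup nV_Bij by metis
qed

lemma carries_ginv: "carries f P Q \<Longrightarrow> carries (ginv f) Q P"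
  using carries_inv ginv_eq carries_carrier by simp

lemma mul_apply: "f \<in> carrier (nV n) \<Longrightarrow> g \<in> carrier (nV n) \<Longrightarrow> x \<in> X \<Longrightarrow> (g \<bullet> f) x = g (f x)"
  by (simp add: mult_nV compose_eq)

lemma mul_image: "f \<in> carrier (nV n) \<Longrightarrow> g \<in> carrier (nV n) \<Longrightarrow> B \<subseteq> X \<Longrightarrow> (g \<bullet> f) ` B = g ` f ` B"
  by (auto simp: mul_apply subset_eq image_iff intro!: bexI)

lemma ginv_image:
  assumes "f \<in> carrier (nV n)" "B \<subseteq> X"
  shows "ginv f ` f ` B = B"
proof -
  have "(ginv f \<bullet> f) ` B = (\<lambda>x\<in>X. x) ` B" using assms(1) by (simp add: one_nV)
  also have "\<dots> = B" using assms(2) by auto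
  finally show ?thesis using mul_image[OF assms(1) inv_closed[OF assms(1)] assms(2)] by simp
qed

lemma meet_subset:
  assumes "B \<in> meet P Q"
  shows "\<exists>C\<in>P. B \<subseteq> C" "\<exists>C\<in>Q. B \<subseteq> C"
  using assms unfolding meet_def by auto

text \<open>The domain is refined first. Refining the range afterwards only shrinks the boxes of the
  domain, so they stay inside boxes of \<open>R\<close>.\<close>

lemma carries_meet_both:
  assumes "carries f P Q" "pat X R" "pat X S"
  obtains P' Q' where "carries f P' Q'" "\<forall>B\<in>P'. \<exists>C\<in>R. B \<subseteq> C" "\<forall>B\<in>Q'. \<exists>C\<in>S. B \<subseteq> C"
proof -
  let ?P = "meet P R" and ?Q = "image f ` meet P R"
  have "carries f ?P ?Q" by (rule carries_meet[OF assms(1,2)])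
  then obtain P' where P': "carries f P' (meet ?Q S)" by (rule carries_meet_range[OF _ assms(3)])
  have "\<exists>C\<in>R. B \<subseteq> C" if "B \<in> P'" for B
  proof -
    have "f ` B \<in> meet ?Q S" by (rule carriesD(5)[OF P' that])
    then obtain D where D: "D \<in> ?P" "f ` B \<subseteq> f ` D" using meet_subset(1) by blast
    obtain C where C: "C \<in> R" "D \<subseteq> C" using meet_subset(2)[OF D(1)] by blast
    have "B \<subseteq> X" "D \<subseteq> X" using pat_Ball(2)[OF carriesD(2)[OF P'] that] C(2) pat_Ball(2)[OF assms(2) C(1)] by auto
    then have "B \<subseteq> D"
      using D(2) inj_on_image_mem_iff[OF Bij_inj[OF carriesD(1)[OF P']], of _ D] by blast
    then show ?thesis using C by blast
  qed
  moreover have "\<forall>B\<in>meet ?Q S. \<exists>C\<in>S. B \<subseteq> C" using meet_subset(2) by blast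
  ultimately show thesis using that[OF P'] by simp
qed

section \<open>Generation by transpositions\<close>

text \<open>The pattern is an argument because the same element swaps \<open>A\<close> and
  \<open>B\<close> in every pattern containing them (\<open>swaps_transfer\<close>).
  \<open>transpose\<close> acts here on boxes, not on points.\<close>

definition swaps where
  "swaps f P A B \<longleftrightarrow> A \<in> P \<and> B \<in> P \<and> A \<noteq> B \<and> carries f P P \<and> (\<forall>C\<in>P. f ` C = transpose A B C)"

lemma transposition_iff: "transposition n f \<longleftrightarrow> (\<exists>P A B. swaps f P A B)"
proof
  assume "transposition n f"
  then obtain P k l where kl: "k < length P" "l < length P" "k \<noteq> l"
    and det: "determines n P (P[k := P ! l, l := P ! k]) f"
    unfolding transposition_def by blast
  let ?Q = "P[k := P ! l, l := P ! k]"
  have d: "distinct P" and Q: "?Q = map (image f) P" and c: "carries f (set P) (set ?Q)"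
    using det unfolding determines_iff by auto
  have "f ` (P ! m) = transpose (P ! k) (P ! l) (P ! m)" if "m < length P" for m
  proof -
    have "f ` (P ! m) = ?Q ! m" using Q that by simp
    also have "\<dots> = transpose (P ! k) (P ! l) (P ! m)"
      using that kl d by (auto simp: nth_list_update nth_eq_iff_index_eq transpose_def)
    finally show ?thesis .
  qed
  then have "\<forall>C\<in>set P. f ` C = transpose (P ! k) (P ! l) C"
    by (simp only: all_set_conv_all_nth) simp
  moreover have "set ?Q = set P" using kl by simp
  ultimately show "\<exists>P A B. swaps f P A B"
    unfolding swaps_def using kl d c
    by (intro exI[of _ "set P"] exI[of _ "P ! k"] exI[of _ "P ! l"]) (simp add: nth_eq_iff_index_eq)
next
  assume "\<exists>P A B. swaps f P A B"
  then obtain P A B where AB: "A \<in> P" "B \<in> P" "A \<noteq> B" and c: "carries f P P"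
    and f: "\<forall>C\<in>P. f ` C = transpose A B C" unfolding swaps_def by blast
  obtain xs where xs: "set xs = P" "distinct xs"
    using finite_distinct_list[OF pat_finite[OF carriesD(2)[OF c]]] by blast
  obtain k l where kl: "k < length xs" "xs ! k = A" "l < length xs" "xs ! l = B"
    using AB xs(1) by (metis in_set_conv_nth)
  let ?Q = "xs[k := xs ! l, l := xs ! k]"
  have "k \<noteq> l" using AB kl by blast
  have "?Q ! m = f ` (xs ! m)" if "m < length xs" for m
  proof -
    have "f ` (xs ! m) = transpose A B (xs ! m)" using f nth_mem[OF that] xs(1) by simp
    also have "\<dots> = ?Q ! m"
      unfolding kl(2,4)[symmetric] using that kl(1,3) xs(2) \<open>k \<noteq> l\<close> by (auto simp: nth_list_update nth_eq_iff_index_eq transpose_def)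
    finally show ?thesis ..
  qed
  then have "?Q = map (image f) xs" by (intro nth_equalityI) simp_all
  moreover have "set ?Q = P" using kl(1,3) xs(1) by simp
  ultimately have "determines n xs ?Q f" using xs c unfolding determines_iff by simp
  then show "transposition n f" unfolding transposition_def using kl \<open>k \<noteq> l\<close> by blast
qed

lemma carries_mul_image:
  "carries f P Q \<Longrightarrow> carries g R S \<Longrightarrow> B \<in> P \<Longrightarrow> (g \<bullet> f) ` B = g ` f ` B"
  by (intro mul_image) (auto intro: carries_carrier dest: carriesD(2) pat_Ball(2))

lemma carries_permutation:
  assumes "pat X P" "bij_betw \<sigma> P P"
  obtains f where "carries f P P" "\<And>B. B \<in> P \<Longrightarrow> f ` B = \<sigma> B"
  using carries_exists[OF assms(1,1,2)] by blast

lemma swaps_exists: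
  assumes "pat X P" "A \<in> P" "B \<in> P" "A \<noteq> B"
  obtains f where "swaps f P A B"
proof -
  obtain f where f: "carries f P P" "\<And>C. C \<in> P \<Longrightarrow> f ` C = transpose A B C"
    using carries_permutation[OF assms(1), of "transpose A B"] assms(2,3) by auto
  show thesis by (rule that[of f], unfold swaps_def, intro conjI ballI assms f)
qed

abbreviation "H \<equiv> generate (nV n) {f. transposition n f}"

lemma transposition_carrier: "{f. transposition n f} \<subseteq> carrier (nV n)"
  unfolding transposition_iff swaps_def using carries_carrier by blast

sublocale H: subgroup H "nV n"
  by (rule generate_is_subgroup[OF transposition_carrier])

lemma swaps_H: "swaps f P A B \<Longrightarrow> f \<in> H"
  using transposition_iff by (intro generate.incl) blast

lemma mul_H_cancel:
  assumes "g \<bullet> f \<in> H" "g \<in> H" "f \<in> carrier (nV n)"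
  shows "f \<in> H"
proof -
  have "f = ginv g \<bullet> (g \<bullet> f)"
    using assms(3) H.mem_carrier[OF assms(2)] by (simp flip: m_assoc)
  also have "\<dots> \<in> H" using assms by simp
  finally show ?thesis .
qed

text \<open>The elements permuting the boxes of one pattern form a finite symmetric group, which
  transpositions generate. The induction is on the number of boxes moved.\<close>

lemma carries_self_H: "carries f P P \<Longrightarrow> f \<in> H"
proof (induction "card {B \<in> P. f ` B \<noteq> B}" arbitrary: f rule: less_induct)
  case less
  note f = less.prems
  have P: "pat X P" by (rule carriesD(2)[OF f])
  show ?case
  proof (cases "\<forall>B\<in>P. f ` B = B")
    case True
    have "f = \<one>\<^bsub>nV n\<^esub>"
      unfolding one_nV
    proof (rule carries_unique[OF f carries_id[OF P]])
      fix B assume "B \<in> P"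
      then show "f ` B = (\<lambda>x\<in>X. x) ` B" using True pat_Ball(2)[OF P] by auto
    qed
    then show ?thesis by simp
  next
    case False
    then obtain B where B: "B \<in> P" "f ` B \<noteq> B" by blast
    \<comment> \<open>Swapping the image of \<open>B\<close> back to \<open>B\<close> makes
      \<open>B\<close> fixed and disturbs no fixed box: a box fixed by \<open>f\<close> is neither
      \<open>B\<close> nor, by injectivity, its image.\<close>
    obtain s where s: "swaps s P (f ` B) B"
      using swaps_exists[OF P carriesD(5)[OF f B(1)] B] .
    then have sc: "carries s P P" and s_img: "C \<in> P \<Longrightarrow> s ` C = transpose (f ` B) B C" for C
      unfolding swaps_def by auto
    have c: "carries (s \<bullet> f) P P" by (rule carries_mult[OF f sc])
    have img: "(s \<bullet> f) ` C = transpose (f ` B) B (f ` C)" if "C \<in> P" for C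
      using carries_mul_image[OF f sc that] s_img[OF carriesD(5)[OF f that]] by simp
    have fixed: "(s \<bullet> f) ` C = C" if "C \<in> P" "f ` C = C" for C
    proof -
      have "C \<noteq> B" using that(2) B(2) by blast
      then have "C \<noteq> f ` B"
        using bij_betw_imp_inj_on[OF carries_bij_betw[OF f]] that B(1) inj_onD by metis
      with \<open>C \<noteq> B\<close> show ?thesis using img[OF that(1)] that(2) by simp
    qed
    have "{C \<in> P. (s \<bullet> f) ` C \<noteq> C} \<subset> {C \<in> P. f ` C \<noteq> C}"
    proof
      show "{C \<in> P. (s \<bullet> f) ` C \<noteq> C} \<subseteq> {C \<in> P. f ` C \<noteq> C}" using fixed by blast
      have "B \<notin> {C \<in> P. (s \<bullet> f) ` C \<noteq> C}" using img[OF B(1)] by simp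
      then show "{C \<in> P. (s \<bullet> f) ` C \<noteq> C} \<noteq> {C \<in> P. f ` C \<noteq> C}" using B by blast
    qed
    then have "card {C \<in> P. (s \<bullet> f) ` C \<noteq> C} < card {C \<in> P. f ` C \<noteq> C}"
      using pat_finite[OF P] by (intro psubset_card_mono) auto
    then have "s \<bullet> f \<in> H" using less.hyps c by blast
    then show ?thesis using mul_H_cancel swaps_H[OF s] carries_carrier[OF f] by blast
  qed
qed

section \<open>Equivalence of patterns modulo transpositions\<close>

definition equivalent :: "(nat \<Rightarrow> real) set set \<Rightarrow> (nat \<Rightarrow> real) set set \<Rightarrow> bool" where
  "equivalent P Q \<longleftrightarrow> (\<exists>f\<in>H. carries f P Q)"

text \<open>Two elements carrying \<open>P\<close> to \<open>Q\<close> differ by a permutation of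
  the boxes of \<open>P\<close>. So one element of \<open>H\<close> from \<open>P\<close> to
  \<open>Q\<close> puts all of them into \<open>H\<close>.\<close>

lemma equivalent_H:
  assumes "equivalent P Q" "carries g P Q"
  shows "g \<in> H"
proof -
  obtain f where f: "f \<in> H" "carries f P Q" using assms(1) unfolding equivalent_def by blast
  have "ginv f \<bullet> g \<in> H"
    by (rule carries_self_H[OF carries_mult[OF assms(2) carries_ginv[OF f(2)]]])
  then show ?thesis using mul_H_cancel f(1) carries_carrier[OF assms(2)] H.m_inv_closed by blast
qed

lemma equivalent_refl: "pat X P \<Longrightarrow> equivalent P P"
  unfolding equivalent_def using carries_id carries_self_H by blast

lemma equivalent_trans: "equivalent P Q \<Longrightarrow> equivalent Q R \<Longrightarrow> equivalent P R"
  unfolding equivalent_def using carries_mult H.m_closed by blast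

text \<open>\<open>B\<close> and \<open>C\<close> need not correspond: a permutation
  \<open>h\<close> of the boxes of \<open>Q\<close>, itself in \<open>H\<close>, first moves the
  image of \<open>B\<close> to \<open>C\<close>.\<close>

lemma equivalent_cut:
  assumes "equivalent P Q" "B \<in> P" "C \<in> Q" "j \<in> I"
  shows "equivalent (cut j B P) (cut j C Q)"
proof -
  obtain f where f: "f \<in> H" "carries f P Q" using assms(1) unfolding equivalent_def by blast
  have Q: "pat X Q" by (rule carriesD(3)[OF f(2)])
  have fB: "f ` B \<in> Q" by (rule carriesD(5)[OF f(2) assms(2)])
  then obtain h where h: "carries h Q Q" "\<And>D. D \<in> Q \<Longrightarrow> h ` D = transpose (f ` B) C D"
    using carries_permutation[OF Q, of "transpose (f ` B) C"] assms(3) by auto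
  have "(h \<bullet> f) ` B = C" using carries_mul_image[OF f(2) h(1) assms(2)] h(2)[OF fB] by simp
  then have "carries (h \<bullet> f) (cut j B P) (cut j C Q)"
    using carries_cut(1)[OF carries_mult[OF f(2) h(1)] assms(2,4)] by simp
  then show ?thesis unfolding equivalent_def using carries_self_H[OF h(1)] f(1) by blast
qed

subsection \<open>Baker's maps\<close>

text \<open>For \<open>i \<noteq> j\<close>, \<open>B\<close> is stretched by two in direction
  \<open>i\<close>, compressed by two in direction \<open>j\<close>, and its two pieces are stacked
  in direction \<open>j\<close>. The map is defined by its values, so that it can be used with every
  pattern containing \<open>B\<close>.\<close>

definition baker :: "nat \<Rightarrow> nat \<Rightarrow> (nat \<Rightarrow> real) set \<Rightarrow> ((nat \<Rightarrow> real) \<Rightarrow> nat \<Rightarrow> real) \<Rightarrow> bool" where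
  "baker i j B f \<longleftrightarrow> f \<in> Bij X \<and>
     (\<forall>e. \<forall>x\<in>half i e B. f x = aff (half i e B) (half j e B) x) \<and> (\<forall>x\<in>X - B. f x = x)"

lemma baker_carries:
  assumes f: "baker i j B f" and P: "pat X P" "B \<in> P" and ij: "i \<in> I" "j \<in> I"
  shows "carries f (cut i B P) (cut j B P)" "f ` half i e B = half j e B"
proof -
  have on_half: "f x = aff (half i e B) (half j e B) x" if "x \<in> half i e B" for x e
    using f that unfolding baker_def by blast
  have B: "box B" by (rule pat_Ball(1)[OF P])
  have img: "f ` half i e B = half j e B" for e
  proof -
    have "f ` half i e B = aff (half i e B) (half j e B) ` half i e B"
      using on_half by (intro image_cong) auto
    then show ?thesis using aff_image box_half B by simp
  qed
  then show "f ` half i e B = half j e B" .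
  have off: "f x = x" if "x \<in> C" "C \<in> P - {B}" for x C
    using that f pat_X_disjoint[OF P(1) _ P(2)] pat_Ball(2)[OF P(1)] unfolding baker_def by blast
  have off_img: "f ` C = C" if "C \<in> P - {B}" for C using off that by force
  have "image f ` (P - {B}) = (\<lambda>C. C) ` (P - {B})" by (rule image_cong[OF refl off_img])
  then have "image f ` cut i B P = cut j B P" unfolding cut_def using img by simp
  moreover have "f x = aff C (f ` C) x" if C: "C \<in> cut i B P" "x \<in> C" for C x
  proof (cases "C \<in> P - {B}")
    case True
    then show ?thesis using off[OF C(2) True] off_img[OF True] aff_id pat_Ball(1)[OF P(1)] C(2) by simp
  next
    case False
    then obtain e where "C = half i e B" using C(1) unfolding cut_def by blast
    then show ?thesis using on_half[of x e] img[of e] C by simp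
  qed
  ultimately show "carries f (cut i B P) (cut j B P)"
    using f pat_cut[OF P ij(1)] pat_cut[OF P ij(2)] unfolding baker_def by (intro carriesI) auto
qed

lemma baker_exists:
  assumes P: "pat X P" "B \<in> P" and ij: "i \<in> I" "j \<in> I"
  obtains f where "baker i j B f"
proof -
  let ?\<sigma> = "\<lambda>C. if C = half i False B then half j False B else if C = half i True B then half j True B else C"
  have neq: "half i False B \<noteq> half i True B" "half j False B \<noteq> half j True B"
    using half_neq[OF pat_Ball(1)[OF P]] ij by auto
  have notin: "half i e B \<notin> P" "half j e B \<notin> P" for e
    using half_notin_pat[OF P] ij by auto
  have "?\<sigma> C = C" if "C \<in> P - {B}" for C using that notin(1) by auto
  then have "?\<sigma> ` (P - {B}) = (\<lambda>C. C) ` (P - {B})" by (rule image_cong[OF refl])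
  then have image: "?\<sigma> ` cut i B P = cut j B P"
    unfolding cut_def image_insert using neq(1) by simp
  \<comment> \<open>A surjection between finite sets of equal size is injective; this spares
    comparing new boxes with old ones.\<close>
  have "inj_on ?\<sigma> (cut i B P)"
    by (rule eq_card_imp_inj_on)
      (simp_all only: image pat_finite[OF pat_cut[OF P ij(1)]] card_cut[OF P ij(1)] card_cut[OF P ij(2)])
  with image have bij: "bij_betw ?\<sigma> (cut i B P) (cut j B P)" by (simp only: bij_betw_def)
  obtain f where f: "carries f (cut i B P) (cut j B P)" "\<And>C. C \<in> cut i B P \<Longrightarrow> f ` C = ?\<sigma> C"
    by (rule carries_exists[OF pat_cut[OF P ij(1)] pat_cut[OF P ij(2)] bij]) (rule that)
  have "f x = aff (half i e B) (half j e B) x" if "x \<in> half i e B" for x e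
  proof -
    have mem: "half i e B \<in> cut i B P" unfolding cut_def by (cases e) auto
    have "?\<sigma> (half i e B) = half j e B" using neq by (cases e) auto
    then have "f ` half i e B = half j e B" using f(2)[OF mem] by (simp only:)
    then show ?thesis using carriesD(6)[OF f(1) mem that] by (simp only:)
  qed
  moreover have "f x = x" if x: "x \<in> X - B" for x
  proof -
    obtain C where C: "C \<in> P" "x \<in> C" using pat_cover[OF P(1)] x by blast
    then have mem: "C \<in> cut i B P" using x unfolding cut_def by blast
    have "?\<sigma> C = C" using notin C by auto
    then have "f ` C = C" using f(2)[OF mem] by (simp only:)
    then have "f x = aff C C x" using carriesD(6)[OF f(1) mem C(2)] by (simp only:)
    then show ?thesis using aff_id[OF pat_Ball(1)[OF P(1) C(1)] C(2)] by simp
  qed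
  ultimately show thesis using that carriesD(1)[OF f(1)] unfolding baker_def by blast
qed

text \<open>In both the domain and the range pattern of the quotient, one of \<open>A\<close>,
  \<open>B\<close> is cut in direction \<open>i\<close> and the other in direction \<open>j\<close>.
  These patterns are equivalent because \<open>equivalent_cut\<close> lets \<open>A\<close> and
  \<open>B\<close> exchange their roles.\<close>

lemma baker_quotient_H:
  assumes P: "pat X P" "A \<in> P" "B \<in> P" "A \<noteq> B" and ij: "i \<in> I" "j \<in> I"
    and f: "baker i j A f" and g: "baker i j B g"
  shows "f \<bullet> ginv g \<in> H"
proof -
  have B: "B \<in> cut i A P" "B \<in> cut j A P" and A: "A \<in> cut i B P" "A \<in> cut j B P"
    using P(2-4) in_cut_other by auto
  have "carries g (cut i B (cut i A P)) (cut j B (cut i A P))"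
    by (rule baker_carries(1)[OF g pat_cut[OF P(1,2) ij(1)] B(1) ij])
  then have "carries (ginv g) (cut j B (cut i A P)) (cut i A (cut i B P))"
    using carries_ginv cut_commute[OF P ij(1) ij(1)] by simp
  moreover have "carries f (cut i A (cut i B P)) (cut j A (cut i B P))"
    by (rule baker_carries(1)[OF f pat_cut[OF P(1,3) ij(1)] A(1) ij])
  ultimately have "carries (f \<bullet> ginv g) (cut j B (cut i A P)) (cut j A (cut i B P))"
    by (rule carries_mult)
  moreover have "equivalent (cut j B (cut i A P)) (cut j A (cut i B P))"
    using equivalent_cut[OF equivalent_cut[OF equivalent_refl[OF P(1)] P(2,3) ij(1)] B(1) A(1) ij(2)] .
  ultimately show ?thesis by (rule equivalent_H[rotated])
qed

text \<open>For \<open>i \<noteq> j\<close> the first set on the right consists of the four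
  quadrants of \<open>B\<close>, a description symmetric in the two directions.\<close>

lemma cut_halves:
  assumes P: "pat X P" "B \<in> P" and ij: "i \<in> I" "j \<in> I"
  shows "cut i (half j False B) (cut i (half j True B) (cut j B P)) =
    {half i e (half j e' B) |e e'. True} \<union> (P - {B})"
proof -
  let ?C = "half j False B" and ?D = "half j True B"
  have CD: "?C \<noteq> ?D" "?C \<notin> P" "?D \<notin> P"
    using half_neq[OF pat_Ball(1)[OF P] ij(2)] half_notin_pat[OF P ij(2)] by auto
  have "half i e ?D \<noteq> ?C" for e
    using half_notin_pat[OF pat_cut[OF P ij(2)] half_in_cut ij(1), of e] half_in_cut by metis
  moreover have "cut i ?D (cut j B P) = {half i False ?D, half i True ?D, ?C} \<union> (P - {B})"
    unfolding cut_def[of i] cut_def[of j] using CD by auto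
  ultimately have "cut i ?C (cut i ?D (cut j B P)) =
      {half i False ?C, half i True ?C, half i False ?D, half i True ?D} \<union> (P - {B})"
    unfolding cut_def[of i ?C] using CD by auto
  also have "{half i False ?C, half i True ?C, half i False ?D, half i True ?D} =
      {half i e (half j e' B) |e e'. True}"
    by (auto simp: ex_bool_eq)
  finally show ?thesis .
qed

lemma cut_halves_commute:
  assumes P: "pat X P" "B \<in> P" and ij: "i \<in> I" "j \<in> I" "i \<noteq> j"
  shows "cut i (half j False B) (cut i (half j True B) (cut j B P)) =
    cut j (half i False B) (cut j (half i True B) (cut i B P))"
  unfolding cut_halves[OF P ij(1,2)] cut_halves[OF P ij(2,1)]
  using half_commute[OF pat_Ball(1)[OF P] ij(3)] by auto

text \<open>\<open>f\<close> and \<open>f0 \<bullet> f1\<close> both carry the four strips of \<open>B\<close> to its four quadrants.\<close>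

lemma baker_halves_H:
  assumes P: "pat X P" "B \<in> P" and ij: "i \<in> I" "j \<in> I" "i \<noteq> j"
    and f: "baker i j B f" and f0: "baker i j (half i False B) f0" and f1: "baker i j (half i True B) f1"
  shows "f0 \<bullet> (f1 \<bullet> ginv f) \<in> H"
proof -
  let ?A = "half i False B" and ?B = "half i True B" and ?P = "cut i B P" and ?Q = "cut j B P"
  have iP: "pat X ?P" by (rule pat_cut[OF P ij(1)])
  have AB: "?A \<in> ?P" "?B \<in> ?P" "?A \<noteq> ?B"
    using half_in_cut half_neq[OF pat_Ball(1)[OF P] ij(1)] by auto
  have AB': "?A \<in> cut i ?B ?P" "?A \<in> cut j ?B ?P" "?B \<in> cut i ?A ?P"
    using AB in_cut_other by auto
  note c = baker_carries[OF f P ij(1,2)]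
  have "carries f (cut i ?B ?P) (cut i (half j True B) ?Q)"
    using carries_cut(1)[OF c(1) AB(2) ij(1)] c(2) by simp
  from carries_cut(1)[OF this AB'(1) ij(1)]
  have "carries f (cut i ?A (cut i ?B ?P)) (cut i (half j False B) (cut i (half j True B) ?Q))"
    using c(2) by simp
  then have "carries f (cut i ?A (cut i ?B ?P)) (cut j ?A (cut j ?B ?P))"
    unfolding cut_halves_commute[OF P ij] .
  then have "carries (ginv f) (cut j ?A (cut j ?B ?P)) (cut i ?A (cut i ?B ?P))"
    by (rule carries_ginv)
  moreover have "carries f1 (cut i ?A (cut i ?B ?P)) (cut i ?A (cut j ?B ?P))"
    using baker_carries(1)[OF f1 pat_cut[OF iP AB(1) ij(1)] AB'(3) ij(1,2)]
      cut_commute[OF iP AB ij(1,1)] cut_commute[OF iP AB ij(1,2)] by simp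
  ultimately have "carries (f1 \<bullet> ginv f) (cut j ?A (cut j ?B ?P)) (cut i ?A (cut j ?B ?P))"
    by (rule carries_mult)
  moreover have "carries f0 (cut i ?A (cut j ?B ?P)) (cut j ?A (cut j ?B ?P))"
    by (rule baker_carries(1)[OF f0 pat_cut[OF iP AB(2) ij(2)] AB'(2) ij(1,2)])
  ultimately have "carries (f0 \<bullet> (f1 \<bullet> ginv f)) (cut j ?A (cut j ?B ?P)) (cut j ?A (cut j ?B ?P))"
    by (rule carries_mult)
  then show ?thesis by (rule carries_self_H)
qed

lemma baker_carrier:
  "baker i j B f \<Longrightarrow> pat X P \<Longrightarrow> B \<in> P \<Longrightarrow> i \<in> I \<Longrightarrow> j \<in> I \<Longrightarrow> f \<in> carrier (nV n)"
  by (rule carries_carrier[OF baker_carries(1)])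

text \<open>\<open>B\<close> overlaps its halves, so their baker's maps cannot be compared directly.
  The box \<open>C\<close> is disjoint from all of them, and its baker's map \<open>g\<close> serves
  as the go-between.\<close>

lemma baker_H_of_not_singleton:
  assumes P: "pat X P" "B \<in> P" "C \<in> P" "C \<noteq> B" and ij: "i \<in> I" "j \<in> I" "i \<noteq> j"
    and f: "baker i j B f"
  shows "f \<in> H"
proof -
  let ?A = "half i False B" and ?B = "half i True B" and ?P = "cut i B P"
  have iP: "pat X ?P" by (rule pat_cut[OF P(1,2) ij(1)])
  have mem: "?A \<in> ?P" "?B \<in> ?P" "C \<in> ?P" using half_in_cut in_cut_other P by auto
  have neq: "?A \<noteq> C" "?B \<noteq> C" using half_notin_pat[OF P(1,2) ij(1)] P(3) by auto
  obtain f0 where f0: "baker i j ?A f0" by (rule baker_exists[OF iP mem(1) ij(1,2)])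
  obtain f1 where f1: "baker i j ?B f1" by (rule baker_exists[OF iP mem(2) ij(1,2)])
  obtain g where g: "baker i j C g" by (rule baker_exists[OF P(1,3) ij(1,2)])
  have c: "f \<in> carrier (nV n)" "f0 \<in> carrier (nV n)" "f1 \<in> carrier (nV n)" "g \<in> carrier (nV n)"
    using baker_carrier[OF f P(1,2) ij(1,2)] baker_carrier[OF f0 iP mem(1) ij(1,2)]
      baker_carrier[OF f1 iP mem(2) ij(1,2)] baker_carrier[OF g P(1,3) ij(1,2)] by auto
  have fg: "f \<bullet> ginv g \<in> H" by (rule baker_quotient_H[OF P(1,2,3) P(4)[symmetric] ij(1,2) f g])
  have gf1: "g \<bullet> ginv f1 \<in> H"
    by (rule baker_quotient_H[OF iP mem(3,2) neq(2)[symmetric] ij(1,2) g f1])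
  have gf0: "g \<bullet> ginv f0 \<in> H"
    by (rule baker_quotient_H[OF iP mem(3,1) neq(1)[symmetric] ij(1,2) g f0])
  have "f0 \<bullet> (f1 \<bullet> ginv f) \<in> H" by (rule baker_halves_H[OF P(1,2) ij f f0 f1])
  \<comment> \<open>The product telescopes to \<open>f0\<close>: the first factor compares
    \<open>f\<close> with the product of \<open>f0\<close> and \<open>f1\<close>, the other two
    replace \<open>f\<close> by \<open>f1\<close> via \<open>g\<close>, and \<open>f1\<close>
    cancels.\<close>
  then have "(f0 \<bullet> (f1 \<bullet> ginv f)) \<bullet> ((f \<bullet> ginv g) \<bullet> (g \<bullet> ginv f1)) \<in> H"
    using fg gf1 by simp
  moreover have "(f0 \<bullet> (f1 \<bullet> ginv f)) \<bullet> ((f \<bullet> ginv g) \<bullet> (g \<bullet> ginv f1)) = f0"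
    using c by (simp add: m_assoc inv_solve_left' flip: m_assoc[of "ginv g" g] m_assoc[of "ginv f" f])
  ultimately have "f0 \<in> H" by simp
  then have "(f \<bullet> ginv g) \<bullet> ((g \<bullet> ginv f0) \<bullet> f0) \<in> H" using fg gf0 by simp
  moreover have "(f \<bullet> ginv g) \<bullet> ((g \<bullet> ginv f0) \<bullet> f0) = f" using c by (simp add: m_assoc)
  ultimately show ?thesis by simp
qed

text \<open>Now \<open>B\<close> may be the whole cube. Once it is cut, each half has the other one
  as the second box that \<open>baker_H_of_not_singleton\<close> asks for.\<close>

lemma baker_H:
  assumes P: "pat X P" "B \<in> P" and ij: "i \<in> I" "j \<in> I" "i \<noteq> j"
    and f: "baker i j B f"
  shows "f \<in> H"
proof -
  let ?A = "half i False B" and ?B = "half i True B" and ?P = "cut i B P"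
  have iP: "pat X ?P" by (rule pat_cut[OF P ij(1)])
  have mem: "?A \<in> ?P" "?B \<in> ?P" using half_in_cut by auto
  have neq: "?A \<noteq> ?B" using half_neq[OF pat_Ball(1)[OF P] ij(1)] .
  obtain f0 where f0: "baker i j ?A f0" by (rule baker_exists[OF iP mem(1) ij(1,2)])
  obtain f1 where f1: "baker i j ?B f1" by (rule baker_exists[OF iP mem(2) ij(1,2)])
  have H: "f0 \<in> H" "f1 \<in> H"
    using baker_H_of_not_singleton[OF iP mem neq[symmetric] ij f0]
      baker_H_of_not_singleton[OF iP mem(2,1) neq ij f1] by auto
  have fc: "f \<in> carrier (nV n)" by (rule baker_carrier[OF f P ij(1,2)])
  have fc': "f1 \<bullet> ginv f \<in> carrier (nV n)" using fc H(2) H.mem_carrier by blast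
  have "ginv f \<in> H"
    by (rule mul_H_cancel[OF mul_H_cancel[OF baker_halves_H[OF P ij f f0 f1] H(1) fc'] H(2)])
      (use fc in simp)
  from H.m_inv_closed[OF this] show ?thesis using fc by simp
qed

lemma equivalent_cut_cut:
  assumes P: "pat X P" "B \<in> P" and ij: "i \<in> I" "j \<in> I"
  shows "equivalent (cut i B P) (cut j B P)"
proof (cases "i = j")
  case True
  then show ?thesis using equivalent_refl pat_cut P ij by simp
next
  case False
  obtain f where f: "baker i j B f" by (rule baker_exists[OF P ij])
  show ?thesis
    unfolding equivalent_def using baker_H[OF P ij False f] baker_carries(1)[OF f P ij] by blast
qed

text \<open>Let the last cut of \<open>P\<close> have direction \<open>i\<close>, and let that of
  \<open>Q\<close> divide \<open>C\<close> in direction \<open>j\<close>. By induction the patterns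
  before these cuts are equivalent, and they stay so when both are cut in direction
  \<open>i\<close>, the second one at \<open>C\<close>. It remains to change the direction at
  \<open>C\<close> from \<open>i\<close> to \<open>j\<close>.\<close>

lemma equivalent_of_card_eq:
  assumes "pat X P" "pat X Q" "card P = card Q"
  shows "equivalent P Q"
  using assms
proof (induction P arbitrary: Q rule: pat.induct)
  case pat_trivial
  show ?case
    using pat_trivial.prems(1)
  proof (cases rule: pat.cases)
    case pat_trivial
    then show ?thesis using equivalent_refl pat.pat_trivial by simp
  next
    case (pat_cut R C j)
    then have "card R = 0" using card_cut[OF pat_cut(2-4)] pat_trivial.prems by simp
    then show ?thesis using pat_cut pat_finite by auto
  qed
next
  case P: (pat_cut P B i)
  from P.prems(1) show ?case
  proof (cases rule: pat.cases)
    case pat_trivial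
    then have "card P = 0" using card_cut[OF P.hyps] P.prems by simp
    then show ?thesis using P pat_finite by auto
  next
    case (pat_cut Q' C j)
    have "card P = card Q'"
      using card_cut[OF P.hyps] card_cut[OF pat_cut(2-4)] P.prems(2) pat_cut(1) by simp
    then have "equivalent P Q'" using P.IH pat_cut by blast
    from equivalent_cut[OF this P.hyps(2) pat_cut(3) P.hyps(3)]
    show ?thesis
      using equivalent_trans equivalent_cut_cut[OF pat_cut(2,3) P.hyps(3) pat_cut(4)] pat_cut(1) by blast
  qed
qed

lemma carries_card: "carries f P Q \<Longrightarrow> card P = card Q"
  using bij_betw_same_card carries_bij_betw by blast

lemma generated_by_transpositions: "H = carrier (nV n)"
proof
  show "H \<subseteq> carrier (nV n)" by (rule H.subset)
  show "carrier (nV n) \<subseteq> H"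
  proof
    fix f assume "f \<in> carrier (nV n)"
    then obtain P Q where f: "carries f P Q" unfolding carrier_nV by blast
    show "f \<in> H"
      by (rule equivalent_H[OF equivalent_of_card_eq f]) (use f in \<open>auto dest: carriesD carries_card\<close>)
  qed
qed

section \<open>Simplicity\<close>

text \<open>Subdividing in one direction is enough to separate two points that differ in this
  coordinate, and it keeps the pattern finite when there are infinitely many coordinates.\<close>

lemma pat_of_width:
  assumes i: "i \<in> I"
  shows "\<exists>R. pat X R \<and> (\<forall>B\<in>R. hi B i - lo B i = 1 / 2 ^ m)"
proof (induction m)
  case 0
  show ?case by (rule exI[of _ "{X}"]) (simp add: pat_trivial i lo_X hi_X)
next
  case (Suc m)
  then obtain R where R: "pat X R" and width: "\<And>B. B \<in> R \<Longrightarrow> hi B i - lo B i = 1 / 2 ^ m"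
    by blast
  let ?R = "\<Union>B\<in>R. cut i B {B}"
  have "pat X ?R" using pat_refine[OF R] pat_cut[OF pat_trivial _ i] by simp
  moreover have "hi C i - lo C i = 1 / 2 ^ Suc m" if "C \<in> ?R" for C
  proof -
    obtain B where B: "B \<in> R" "C \<in> cut i B {B}" using \<open>C \<in> ?R\<close> by blast
    then obtain e where C: "C = half i e B" unfolding cut_def by blast
    have "hi C i - lo C i = (hi B i - lo B i) / 2"
      unfolding C using lo_half[OF pat_Ball(1)[OF R B(1)] i] hi_half[OF pat_Ball(1)[OF R B(1)] i]
      by (simp add: field_simps)
    then show ?thesis using width[OF B(1)] by simp
  qed
  ultimately show ?case by blast
qed

lemma pat_separates:
  assumes "x \<in> X" "y \<in> X" "x \<noteq> y"
  obtains R B C where "pat X R" "B \<in> R" "C \<in> R" "B \<noteq> C" "x \<in> B" "y \<in> C"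
proof -
  have "x \<in> extensional I" "y \<in> extensional I" using assms mem_box[OF box_X] by auto
  then obtain i where i: "i \<in> I" "x i \<noteq> y i" using assms(3) extensionalityI by blast
  then obtain m where m: "1 / 2 ^ m < \<bar>x i - y i\<bar>"
    using real_arch_pow_inv[of "\<bar>x i - y i\<bar>" "1 / 2"] by (auto simp: power_one_over)
  obtain R where R: "pat X R" "\<And>B. B \<in> R \<Longrightarrow> hi B i - lo B i = 1 / 2 ^ m"
    using pat_of_width[OF i(1)] by blast
  obtain B where B: "B \<in> R" "x \<in> B" using pat_cover[OF R(1) assms(1)] by blast
  obtain C where C: "C \<in> R" "y \<in> C" using pat_cover[OF R(1) assms(2)] by blast
  have "B \<noteq> C"
  proof
    assume "B = C"
    then have "lo B i \<le> x i" "x i < hi B i" "lo B i \<le> y i" "y i < hi B i"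
      using mem_box[OF pat_Ball(1)[OF R(1) B(1)]] B C i(1) by auto
    then show False using R(2)[OF B(1)] m by linarith
  qed
  then show thesis using that[OF R(1) B(1) C(1)] B C by blast
qed

text \<open>A swap is the identity off \<open>A\<close> and \<open>B\<close>, and on these two boxes
  it is determined by them. This brings swaps that were found in different patterns into a single
  one.\<close>

lemma swaps_transfer:
  assumes f: "swaps f P A B" and L: "pat X L" "A \<in> L" "B \<in> L"
  shows "swaps f L A B"
proof -
  have AB: "A \<in> P" "B \<in> P" "A \<noteq> B" and c: "carries f P P"
    and img: "\<And>C. C \<in> P \<Longrightarrow> f ` C = transpose A B C"
    using f unfolding swaps_def by auto
  note P = carriesD(2)[OF c]
  have off: "f x = x" if x: "x \<in> X" "x \<notin> A" "x \<notin> B" for x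
  proof -
    obtain C where C: "C \<in> P" "x \<in> C" using pat_cover[OF P x(1)] by blast
    then have "f ` C = C" using img[OF C(1)] x by (metis transpose_apply_other)
    then show ?thesis
      using carriesD(6)[OF c C] aff_id[OF pat_Ball(1)[OF P C(1)] C(2)] by simp
  qed
  have other: "f x = x" if "C \<in> L" "C \<noteq> A" "C \<noteq> B" "x \<in> C" for C x
  proof (rule off)
    show "x \<in> X" using pat_Ball(2)[OF L(1) that(1)] that(4) by blast
    show "x \<notin> A" "x \<notin> B" using pat_X_disjoint[OF L(1)] L that by blast+
  qed
  have imgL: "f ` C = transpose A B C" if C: "C \<in> L" for C
  proof (cases "C = A \<or> C = B")
    case True
    then show ?thesis using img AB by auto
  next
    case False
    then have "f ` C = (\<lambda>x. x) ` C" using other[OF C] by (intro image_cong) auto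
    then show ?thesis using False by simp
  qed
  have "carries f L L"
  proof (rule carriesI[OF carriesD(1)[OF c] L(1) L(1)])
    have "image f ` L = transpose A B ` L" by (rule image_cong[OF refl imgL])
    then show "image f ` L = L" using L by simp
    fix C x assume C: "C \<in> L" "x \<in> C"
    show "f x = aff C (f ` C) x"
    proof (cases "C = A \<or> C = B")
      case True
      then show ?thesis using carriesD(6)[OF c _ C(2)] AB by blast
    next
      case False
      then show ?thesis
        using imgL[OF C(1)] other[OF C(1) _ _ C(2)] aff_id[OF pat_Ball(1)[OF L(1) C(1)] C(2)] by simp
    qed
  qed
  then show ?thesis unfolding swaps_def using L AB imgL by blast
qed

lemma swaps_ginv:
  assumes "swaps f P A B"
  shows "swaps (ginv f) P A B"
proof -
  have AB: "A \<in> P" "B \<in> P" "A \<noteq> B" and c: "carries f P P"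
    and img: "\<And>C. C \<in> P \<Longrightarrow> f ` C = transpose A B C"
    using assms unfolding swaps_def by auto
  have "ginv f ` C = transpose A B C" if "C \<in> P" for C
  proof -
    have mem: "transpose A B C \<in> P" using that AB by (auto simp: transpose_def)
    then have "f ` transpose A B C = C" using img by simp
    then show ?thesis
      using ginv_image[OF carries_carrier[OF c] pat_Ball(2)[OF carriesD(2)[OF c] mem]] by simp
  qed
  then show ?thesis unfolding swaps_def using AB carries_ginv[OF c] by blast
qed

section \<open>Products of two disjoint swaps\<close>

definition double_swaps where
  "double_swaps f P A B C D \<longleftrightarrow> distinct [A, B, C, D] \<and> {A, B, C, D} \<subseteq> P \<and> carries f P P \<and>
     (\<forall>E\<in>P. f ` E = transpose A B (transpose C D E))"

text \<open>The bound 5 provides a box \<open>E\<close> beyond the four swapped ones.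
  \<open>f\<close> maps \<open>E\<close> and each of its halves to itself, so cutting
  \<open>E\<close> adds one fixed box and can be repeated.\<close>

lemma double_swaps_extend:
  assumes "double_swaps f P A B C D" "5 \<le> card P" "card P \<le> k"
  shows "\<exists>P'. double_swaps f P' A B C D \<and> card P' = k"
  using assms(3)
proof (induction k rule: dec_induct)
  case base
  then show ?case using assms(1) by blast
next
  case (step k)
  then obtain Q where Q: "double_swaps f Q A B C D" "card Q = k" by blast
  have mem: "distinct [A, B, C, D]" "{A, B, C, D} \<subseteq> Q" and c: "carries f Q Q"
    and img: "\<And>E. E \<in> Q \<Longrightarrow> f ` E = transpose A B (transpose C D E)"
    using Q(1) unfolding double_swaps_def by auto
  note P = carriesD(2)[OF c]
  have "card {A, B, C, D} < card Q" using Q(2) step.hyps assms(2) mem(1) by simp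
  then obtain E where E: "E \<in> Q" "E \<notin> {A, B, C, D}"
    by (metis card_mono finite.emptyI finite.insertI not_le subsetI)
  have fE: "f ` E = E" using img[OF E(1)] E(2) by simp
  have notin: "half 0 e E \<notin> Q" for e by (rule half_notin_pat[OF P E(1) zero_coord])
  have c': "carries f (cut 0 E Q) (cut 0 E Q)"
    using carries_cut(1)[OF c E(1) zero_coord] fE by simp
  have "f ` F = transpose A B (transpose C D F)" if F: "F \<in> cut 0 E Q" for F
  proof (cases "F \<in> Q")
    case False
    then obtain e where e: "F = half 0 e E" using F unfolding cut_def by blast
    have "f ` F = F" unfolding e using carries_cut(2)[OF c E(1) zero_coord] fE by simp
    moreover have "F \<notin> {A, B, C, D}" using False mem by blast
    ultimately show ?thesis by simp
  qed (rule img)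
  moreover have "{A, B, C, D} \<subseteq> cut 0 E Q" using mem(2) E(2) unfolding cut_def by auto
  ultimately have "double_swaps f (cut 0 E Q) A B C D"
    unfolding double_swaps_def using mem(1) c' by blast
  then show ?case using card_cut[OF P E(1) zero_coord] Q(2) by blast
qed

text \<open>As in a symmetric group, where permutations of equal cycle type are conjugate: once both
  patterns have the same number of boxes, a bijection that respects the four swapped boxes
  intertwines the two elements.\<close>

lemma double_swaps_conjugate:
  assumes f: "double_swaps f P A B C D" "5 \<le> card P"
    and f': "double_swaps f' Q A' B' C' D'" "5 \<le> card Q"
  obtains g where "g \<in> carrier (nV n)" "f' = g \<bullet> f \<bullet> ginv g"
proof -
  let ?k = "max (card P) (card Q)"
  obtain P' where P': "double_swaps f P' A B C D" "card P' = ?k"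
    using double_swaps_extend[OF f, of ?k] by auto
  obtain Q' where Q': "double_swaps f' Q' A' B' C' D'" "card Q' = ?k"
    using double_swaps_extend[OF f', of ?k] by auto
  have memP: "distinct [A, B, C, D]" "{A, B, C, D} \<subseteq> P'" and c: "carries f P' P'"
    and img: "\<And>E. E \<in> P' \<Longrightarrow> f ` E = transpose A B (transpose C D E)"
    using P'(1) unfolding double_swaps_def by auto
  have memQ: "distinct [A', B', C', D']" "{A', B', C', D'} \<subseteq> Q'" and c': "carries f' Q' Q'"
    and img': "\<And>E. E \<in> Q' \<Longrightarrow> f' ` E = transpose A' B' (transpose C' D' E)"
    using Q'(1) unfolding double_swaps_def by auto
  have P: "pat X P'" and Q: "pat X Q'" using carriesD(2) c c' by auto
  let ?P0 = "P' - {A, B, C, D}" and ?Q0 = "Q' - {A', B', C', D'}"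
  have fin: "finite P'" "finite Q'" using pat_finite P Q by auto
  have "card ?P0 = card ?Q0"
    using card_Diff_subset[OF _ memP(2)] card_Diff_subset[OF _ memQ(2)] memP(1) memQ(1) P' Q' by simp
  then obtain \<tau> where \<tau>: "bij_betw \<tau> ?P0 ?Q0"
    using finite_same_card_bij fin by blast
  \<comment> \<open>Away from the four named boxes any bijection \<open>\<tau>\<close> will do,
    because both elements fix the boxes there.\<close>
  define \<sigma> where "\<sigma> E = (if E = A then A' else if E = B then B' else if E = C then C' else
    if E = D then D' else \<tau> E)" for E
  have \<sigma>: "\<sigma> A = A'" "\<sigma> B = B'" "\<sigma> C = C'" "\<sigma> D = D'" using memP(1) by (auto simp: \<sigma>_def)
  have "\<sigma> ` ?P0 = \<tau> ` ?P0" by (intro image_cong) (auto simp: \<sigma>_def)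
  then have "\<sigma> ` ?P0 = ?Q0" using \<tau> by (simp add: bij_betw_def)
  then have "\<sigma> ` ({A, B, C, D} \<union> ?P0) = {A', B', C', D'} \<union> ?Q0"
    by (simp only: image_Un image_insert image_empty \<sigma>)
  then have im: "\<sigma> ` P' = Q'" by (simp only: Un_Diff_cancel Un_absorb1[OF memP(2)] Un_absorb1[OF memQ(2)])
  then have "card (\<sigma> ` P') = card P'" using P'(2) Q'(2) by simp
  then have inj: "inj_on \<sigma> P'" by (rule eq_card_imp_inj_on[OF fin(1)])
  then have bij: "bij_betw \<sigma> P' Q'" using im by (simp add: bij_betw_def)
  obtain g where g: "carries g P' Q'" "\<And>E. E \<in> P' \<Longrightarrow> g ` E = \<sigma> E"
    by (rule carries_exists[OF P Q bij]) (rule that)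
  have \<sigma>_transpose: "\<sigma> (transpose U V E) = transpose (\<sigma> U) (\<sigma> V) (\<sigma> E)"
    if "U \<in> P'" "V \<in> P'" "E \<in> P'" for U V E
    using that inj by (auto simp: transpose_def inj_on_eq_iff)
  have "g \<bullet> f = f' \<bullet> g"
  proof (rule carries_unique[OF carries_mult[OF c g(1)] carries_mult[OF g(1) c']])
    fix E assume E: "E \<in> P'"
    have tr: "transpose C D E \<in> P'" using E memP(2) by (auto simp: transpose_def)
    have fE: "f ` E \<in> P'" by (rule carriesD(5)[OF c E])
    have gE: "\<sigma> E \<in> Q'" using im E by blast
    have "(g \<bullet> f) ` E = \<sigma> (transpose A B (transpose C D E))"
      using carries_mul_image[OF c g(1) E] g(2)[OF fE] img[OF E] by simp
    also have "\<dots> = transpose A' B' (transpose C' D' (\<sigma> E))"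
      using \<sigma>_transpose[of A B "transpose C D E"] \<sigma>_transpose[of C D E] tr memP(2) E by (simp add: \<sigma>)
    also have "\<dots> = (f' \<bullet> g) ` E"
      using carries_mul_image[OF g(1) c' E] g(2)[OF E] img'[OF gE] by simp
    finally show "(g \<bullet> f) ` E = (f' \<bullet> g) ` E" .
  qed
  then have "f' = g \<bullet> f \<bullet> ginv g"
    using carries_carrier[OF c] carries_carrier[OF c'] carries_carrier[OF g(1)] by (simp add: m_assoc)
  then show thesis using that carries_carrier[OF g(1)] by blast
qed

text \<open>The element exchanges the lower halves of \<open>A\<close> and \<open>B\<close>, and
  likewise their upper halves, so it swaps two pairs in the pattern with \<open>A\<close> and
  \<open>B\<close> cut.\<close>

lemma swaps_imp_double_swaps:
  assumes "swaps f P A B"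
  obtains Q C D E F where "double_swaps f Q C D E F" "card Q = card P + 2"
proof -
  have AB: "A \<in> P" "B \<in> P" "A \<noteq> B" and c: "carries f P P"
    and img: "\<And>C. C \<in> P \<Longrightarrow> f ` C = transpose A B C"
    using assms unfolding swaps_def by auto
  note P = carriesD(2)[OF c] and j = zero_coord
  let ?Q = "cut 0 A (cut 0 B P)"
  let ?A = "\<lambda>e. half 0 e A" and ?B = "\<lambda>e. half 0 e B"
  have A: "A \<in> cut 0 B P" and B: "B \<in> cut 0 A P" using AB in_cut_other by auto
  have fAB: "f ` A = B" "f ` B = A" using img AB by auto
  have c1: "carries f (cut 0 B P) (cut 0 A P)"
    using carries_cut(1)[OF c AB(2) j] fAB by simp
  have c2: "carries f ?Q ?Q"
    using carries_cut(1)[OF c1 A j] fAB cut_commute[OF P AB j j] by simp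
  have halves: "f ` ?A e = ?B e" "f ` ?B e = ?A e" for e
    using carries_cut(2)[OF c AB(1) j] carries_cut(2)[OF c AB(2) j] fAB by auto
  have notin: "?A e \<notin> P" "?B e \<notin> P" for e using half_notin_pat[OF P _ j] AB by auto
  have ABneq: "?A e \<noteq> ?B e'" for e e'
    using half_subset[OF pat_Ball(1)[OF P AB(1)] j, of e] half_subset[OF pat_Ball(1)[OF P AB(2)] j, of e']
      pat_X_disjoint[OF P AB] box_nonempty[OF box_half[OF pat_Ball(1)[OF P AB(1)], of 0 e]] by blast
  have neq: "?A False \<noteq> ?A True" "?B False \<noteq> ?B True"
    using half_neq[OF pat_Ball(1)[OF P AB(1)] j] half_neq[OF pat_Ball(1)[OF P AB(2)] j] by auto
  have Q: "?Q = {?A False, ?A True, ?B False, ?B True} \<union> (P - {A, B})"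
    unfolding cut_def using notin(2) AB by (auto simp: insert_commute)
  have fQ: "f ` E = transpose (?A False) (?B False) (transpose (?A True) (?B True) E)" if E: "E \<in> ?Q" for E
  proof -
    consider e where "E = ?A e" | e where "E = ?B e" | "E \<in> P" "E \<noteq> A" "E \<noteq> B"
      using E unfolding Q by blast
    then show ?thesis
    proof cases
      case 1
      then show ?thesis using halves neq ABneq ABneq[symmetric] by (cases e) (simp_all add: transpose_def)
    next
      case 2
      then show ?thesis using halves neq ABneq ABneq[symmetric] by (cases e) (simp_all add: transpose_def)
    next
      case 3
      then have "f ` E = E" using img by simp
      moreover have "E \<noteq> ?A e" "E \<noteq> ?B e" for e using 3 notin by auto
      ultimately show ?thesis by simp
    qed
  qed
  have "double_swaps f ?Q (?A False) (?B False) (?A True) (?B True)"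
    unfolding double_swaps_def
  proof (intro conjI ballI fQ c2)
    show "distinct [?A False, ?B False, ?A True, ?B True]"
      using neq ABneq ABneq[symmetric] by simp
    show "{?A False, ?B False, ?A True, ?B True} \<subseteq> ?Q" unfolding Q by simp
  qed
  moreover have "card ?Q = card P + 2"
    using card_cut[OF pat_cut[OF P AB(2) j] A j] card_cut[OF P AB(2) j] by simp
  ultimately show thesis using that by blast
qed

section \<open>Nontrivial normal subgroups\<close>

lemma normal_contains_double_swaps:
  assumes N: "N \<lhd> nV n" "N \<noteq> {\<one>\<^bsub>nV n\<^esub>}"
  obtains f P A B C D where "f \<in> N" "double_swaps f P A B C D" "5 \<le> card P"
proof -
  interpret N: normal N "nV n" by (rule N(1))
  obtain f where f: "f \<in> N" "f \<noteq> \<one>\<^bsub>nV n\<^esub>" using N(2) N.one_closed by blast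
  have fG: "f \<in> carrier (nV n)" by (rule N.mem_carrier[OF f(1)])
  obtain x where x: "x \<in> X" "f x \<noteq> x"
  proof -
    have "f = (\<lambda>x\<in>X. x)" if "\<forall>x\<in>X. f x = x"
      by (rule extensionalityI[of _ X])
        (use Bij_imp_extensional[OF nV_Bij[OF fG]] that in auto)
    then show thesis using that f(2) one_nV by auto
  qed
  have "f x \<in> X" using x(1) Bij_image[OF nV_Bij[OF fG]] by blast
  then obtain R S T where R: "pat X R" "S \<in> R" "T \<in> R" "S \<noteq> T" "x \<in> S" "f x \<in> T"
    using pat_separates[OF x(1) _ x(2)[symmetric]] by blast
  obtain P0 Q0 where "carries f P0 Q0" using fG unfolding carrier_nV by blast
  then obtain P Q where c: "carries f P Q"
    and sub: "\<forall>B\<in>P. \<exists>C\<in>R. B \<subseteq> C" "\<forall>B\<in>Q. \<exists>C\<in>R. B \<subseteq> C"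
    by (rule carries_meet_both[OF _ R(1) R(1)])
  have P: "pat X P" and Q: "pat X Q" using carriesD(2,3)[OF c] by auto
  obtain A where A: "A \<in> P" "x \<in> A" using pat_cover[OF P x(1)] by blast
  define B where "B = f ` A"
  have B: "B \<in> Q" "f x \<in> B" unfolding B_def using carriesD(5)[OF c A(1)] A(2) by auto
  have AS: "A \<subseteq> S" using sub(1) A pat_X_disjoint[OF R(1) _ R(2)] R(5) by blast
  have BT: "B \<subseteq> T" using sub(2) B pat_X_disjoint[OF R(1) _ R(3)] R(6) by blast
  have ST: "S \<inter> T = {}" by (rule pat_X_disjoint[OF R(1-4)])
  have AB: "A \<inter> B = {}" "A \<noteq> B" "A \<noteq> T" "A \<noteq> {}" "B \<noteq> {}" using AS BT ST A(2) B(2) R(6) by auto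
  \<comment> \<open>\<open>A\<close> belongs to a domain pattern and \<open>B\<close> to a range
    pattern. Subdividing \<open>S\<close> as \<open>P\<close> does and \<open>T\<close> as
    \<open>Q\<close> does gives one pattern that contains both.\<close>
  define K where "K = R - {S} \<union> trace P S - {T} \<union> trace Q T"
  have "pat X (R - {S} \<union> trace P S)"
    by (rule pat_substitute[OF R(1,2) pat_X_trace[OF R(1) P R(2)]])
  then have K: "pat X K"
    unfolding K_def by (rule pat_substitute) (use R(3,4) pat_X_trace[OF R(1) Q R(3)] in auto)
  have "A \<in> trace P S" "B \<in> trace Q T"
    unfolding trace_def using A(1) B(1) AS BT AB by (auto intro!: rev_image_eqI)
  then have AK: "A \<in> K" "B \<in> K" unfolding K_def using AB by auto
  note j = zero_coord
  \<comment> \<open>Swapping two quarters instead of the two halves leaves the upper half of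
    \<open>A\<close> as a fixed fifth box.\<close>
  let ?A = "half 0 False A" and ?B = "half 0 False B"
  let ?Al = "half 0 False ?A" and ?Ar = "half 0 True ?A"
  let ?Bl = "half 0 False ?B" and ?Br = "half 0 True ?B"
  have boxAB: "box A" "box B" using pat_Ball(1) P Q A B by auto
  have boxAB': "box ?A" "box ?B" using box_half boxAB by auto
  have neq: "?Al \<noteq> ?Ar" "?Bl \<noteq> ?Br" using half_neq[OF boxAB'(1) j] half_neq[OF boxAB'(2) j] .
  have quarter_sub: "half 0 e ?A \<subseteq> A" "half 0 e ?B \<subseteq> B" for e
    using subset_trans[OF half_subset[OF boxAB'(1) j] half_subset[OF boxAB(1) j]]
      subset_trans[OF half_subset[OF boxAB'(2) j] half_subset[OF boxAB(2) j]] .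
  have quarter_nonempty: "half 0 e ?A \<noteq> {}" for e
    using box_nonempty[OF box_half[OF boxAB'(1)]] .
  have neqAB: "half 0 e ?A \<noteq> half 0 e' ?B" for e e'
    using quarter_sub(1)[of e] quarter_sub(2)[of e'] AB(1) quarter_nonempty[of e] by blast
  define P2 where "P2 = cut 0 ?A (cut 0 A P)"
  define Q2 where "Q2 = cut 0 ?B (cut 0 B Q)"
  note c1 = carries_cut[OF c A(1) j, folded B_def]
  note c2 = carries_cut[OF c1(1) half_in_cut[of _ False] j, unfolded c1(2), folded P2_def Q2_def]
  have memP2: "?Al \<in> P2" "?Ar \<in> P2" unfolding P2_def using half_in_cut by auto
  have memQ2: "?Bl \<in> Q2" "?Br \<in> Q2" unfolding Q2_def using half_in_cut by auto
  have P2: "pat X P2" and Q2: "pat X Q2" using carriesD(2,3)[OF c2(1)] by auto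
  obtain t where t: "swaps t P2 ?Al ?Ar" by (rule swaps_exists[OF P2 memP2 neq(1)])
  then have tc: "carries t P2 P2" and t_img: "\<And>C. C \<in> P2 \<Longrightarrow> t ` C = transpose ?Al ?Ar C"
    unfolding swaps_def by auto
  have tG: "t \<in> carrier (nV n)" by (rule carries_carrier[OF tc])
  \<comment> \<open>Conjugation by \<open>f\<close> moves the swap from the quarters of
    \<open>A\<close> to those of \<open>B\<close>, because \<open>f\<close> maps each of these
    quarters onto the corresponding one.\<close>
  let ?u = "f \<bullet> (t \<bullet> ginv f)"
  note fi = carries_ginv[OF c2(1)]
  note tfi = carries_mult[OF fi tc]
  have uc: "carries ?u Q2 Q2" by (rule carries_mult[OF tfi c2(1)])
  have u: "swaps ?u Q2 ?Bl ?Br"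
    unfolding swaps_def
  proof (intro conjI ballI memQ2 neq(2) uc)
    fix C assume "C \<in> Q2"
    then obtain D where D: "D \<in> P2" "C = f ` D" using carriesD(4)[OF c2(1)] by blast
    have "ginv f ` C = D" using ginv_image[OF fG pat_Ball(2)[OF P2 D(1)]] D(2) by simp
    then have "?u ` C = f ` transpose ?Al ?Ar D"
      using carries_mul_image[OF tfi c2(1) \<open>C \<in> Q2\<close>] carries_mul_image[OF fi tc \<open>C \<in> Q2\<close>] t_img[OF D(1)]
      by simp
    moreover have "f ` D = ?Bl \<longleftrightarrow> D = ?Al" "f ` D = ?Br \<longleftrightarrow> D = ?Ar"
      using inj_on_eq_iff[OF bij_betw_imp_inj_on[OF carries_bij_betw[OF c2(1)]] D(1)] memP2 c2(2)
      by metis+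
    ultimately show "?u ` C = transpose ?Bl ?Br C"
      unfolding D(2) using c2(2) by (auto simp: transpose_def)
  qed
  \<comment> \<open>So far the two swaps live in the unrelated patterns \<open>P2\<close> and
    \<open>Q2\<close>; \<open>L\<close> contains all four quarters.\<close>
  define L where "L = cut 0 ?B (cut 0 B (cut 0 ?A (cut 0 A K)))"
  have K1: "pat X (cut 0 A K)" by (rule pat_cut[OF K AK(1) j])
  have K2: "pat X (cut 0 ?A (cut 0 A K))" by (rule pat_cut[OF K1 half_in_cut j])
  have "?A \<noteq> B" using half_subset[OF boxAB(1) j, of False] AB by blast
  then have BK2: "B \<in> cut 0 ?A (cut 0 A K)" using AK AB(2) in_cut_other by auto
  have K3: "pat X (cut 0 B (cut 0 ?A (cut 0 A K)))" by (rule pat_cut[OF K2 BK2 j])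
  have L: "pat X L" unfolding L_def by (rule pat_cut[OF K3 half_in_cut j])
  have "half 0 e ?A \<noteq> B" "half 0 e ?A \<noteq> ?B" for e
    using quarter_sub(1)[of e] AB(1) quarter_nonempty[of e] half_subset[OF boxAB(2) j, of False] by blast+
  then have AL: "half 0 e ?A \<in> L" for e
    unfolding L_def using half_in_cut in_cut_other by metis
  have BL: "half 0 e ?B \<in> L" for e unfolding L_def by (rule half_in_cut)
  have cardL: "5 \<le> card L"
  proof -
    have "card L = card K + 4"
      unfolding L_def using card_cut[OF K3 half_in_cut j] card_cut[OF K2 BK2 j]
        card_cut[OF K1 half_in_cut j] card_cut[OF K AK(1) j] by simp
    moreover have "card K \<noteq> 0" using pat_finite[OF K] AK by auto
    ultimately show ?thesis by simp
  qed
  have ti: "swaps (ginv t) L ?Al ?Ar" by (rule swaps_transfer[OF swaps_ginv[OF t] L AL AL])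
  then have tic: "carries (ginv t) L L" and ti_img: "\<And>C. C \<in> L \<Longrightarrow> ginv t ` C = transpose ?Al ?Ar C"
    unfolding swaps_def by auto
  have uL: "swaps ?u L ?Bl ?Br" by (rule swaps_transfer[OF u L BL BL])
  then have ucL: "carries ?u L L" and u_img: "\<And>C. C \<in> L \<Longrightarrow> ?u ` C = transpose ?Bl ?Br C"
    unfolding swaps_def by auto
  have ds: "double_swaps (?u \<bullet> ginv t) L ?Bl ?Br ?Al ?Ar"
    unfolding double_swaps_def
  proof (intro conjI ballI carries_mult[OF tic ucL])
    show "distinct [?Bl, ?Br, ?Al, ?Ar]" using neq neqAB neqAB[symmetric] by simp
    show "{?Bl, ?Br, ?Al, ?Ar} \<subseteq> L" using AL BL by simp
    fix E assume E: "E \<in> L"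
    show "(?u \<bullet> ginv t) ` E = transpose ?Bl ?Br (transpose ?Al ?Ar E)"
      using carries_mul_image[OF tic ucL E] ti_img[OF E] u_img carriesD(5)[OF tic E] by simp
  qed
  \<comment> \<open>The commutator of \<open>f\<close> and \<open>t\<close>, bracketed as
    \<open>f\<close> times a conjugate of its inverse, both of which lie in
    \<open>N\<close>.\<close>
  have "?u \<bullet> ginv t = f \<bullet> (t \<bullet> ginv f \<bullet> ginv t)" using fG tG by (simp add: m_assoc)
  also have "\<dots> \<in> N"
    using N.m_closed[OF f(1) N.inv_op_closed2[OF tG N.m_inv_closed[OF f(1)]]] .
  finally show thesis using that ds cardL by blast
qed

lemma normal_contains_H:
  assumes N: "N \<lhd> nV n" "N \<noteq> {\<one>\<^bsub>nV n\<^esub>}"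
  shows "H \<subseteq> N"
proof -
  interpret N: normal N "nV n" by (rule N(1))
  obtain f P A B C D where f: "f \<in> N" "double_swaps f P A B C D" "5 \<le> card P"
    by (rule normal_contains_double_swaps[OF N])
  have double: "g \<in> N" if g: "double_swaps g Q A' B' C' D'" "5 \<le> card Q" for g Q A' B' C' D'
  proof -
    obtain h where "h \<in> carrier (nV n)" "g = h \<bullet> f \<bullet> ginv h"
      by (rule double_swaps_conjugate[OF f(2,3) g])
    then show ?thesis using N.inv_op_closed2 f(1) by simp
  qed
  \<comment> \<open>The bound 3 becomes the bound 5 of \<open>double\<close>, as halving the two
    swapped boxes adds two boxes.\<close>
  have proper: "g \<in> N" if g: "swaps g Q A' B'" "3 \<le> card Q" for g Q A' B'
  proof -
    obtain Q' C D E F where "double_swaps g Q' C D E F" "card Q' = card Q + 2"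
      by (rule swaps_imp_double_swaps[OF g(1)])
    then show ?thesis using double g(2) by auto
  qed
  \<comment> \<open>The pattern may consist of two boxes only. After halving there are at least
    four, and the two factors of the double swap are swaps to which \<open>proper\<close>
    applies.\<close>
  have "g \<in> N" if g: "swaps g Q A' B'" for g Q A' B'
  proof -
    obtain Q' C D E F where Q': "double_swaps g Q' C D E F"
      by (rule swaps_imp_double_swaps[OF g])
    then have mem: "distinct [C, D, E, F]" "{C, D, E, F} \<subseteq> Q'" and c: "carries g Q' Q'"
      and img: "\<And>E'. E' \<in> Q' \<Longrightarrow> g ` E' = transpose C D (transpose E F E')"
      unfolding double_swaps_def by auto
    have P: "pat X Q'" by (rule carriesD(2)[OF c])
    have "card {C, D, E, F} \<le> card Q'" by (rule card_mono[OF pat_finite[OF P] mem(2)])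
    then have card: "3 \<le> card Q'" using mem(1) by simp
    obtain u where u: "swaps u Q' C D" by (rule swaps_exists[OF P, of C D]) (use mem in auto)
    obtain v where v: "swaps v Q' E F" by (rule swaps_exists[OF P, of E F]) (use mem in auto)
    have uc: "carries u Q' Q'" "\<And>E'. E' \<in> Q' \<Longrightarrow> u ` E' = transpose C D E'"
      using u unfolding swaps_def by auto
    have vc: "carries v Q' Q'" "\<And>E'. E' \<in> Q' \<Longrightarrow> v ` E' = transpose E F E'"
      using v unfolding swaps_def by auto
    have "g = u \<bullet> v"
    proof (rule carries_unique[OF c carries_mult[OF vc(1) uc(1)]])
      fix E' assume E': "E' \<in> Q'"
      show "g ` E' = (u \<bullet> v) ` E'"
        using carries_mul_image[OF vc(1) uc(1) E'] vc(2)[OF E'] uc(2) carriesD(5)[OF vc(1) E'] img[OF E']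
        by simp
    qed
    then show ?thesis using proper[OF u card] proper[OF v card] N.m_closed by simp
  qed
  then have "{f. transposition n f} \<subseteq> N" unfolding transposition_iff by blast
  then show ?thesis by (rule generate_subgroup_incl[OF _ N.subgroup_axioms])
qed

lemma nV_nontrivial: "carrier (nV n) \<noteq> {\<one>\<^bsub>nV n\<^esub>}"
proof -
  let ?P = "cut 0 X {X}" and ?A = "half 0 False X" and ?B = "half 0 True X"
  have P: "pat X ?P" by (rule pat_cut[OF pat_trivial _ zero_coord]) simp
  have neq: "?A \<noteq> ?B" by (rule half_neq[OF box_X zero_coord])
  obtain f where f: "swaps f ?P ?A ?B" by (rule swaps_exists[OF P half_in_cut half_in_cut neq])
  then have "f ` ?A = ?B" "f \<in> carrier (nV n)"
    unfolding swaps_def using carries_carrier by auto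
  moreover have "(\<lambda>x\<in>X. x) ` ?A = ?A" using half_subset[OF box_X zero_coord, of False] by auto
  ultimately show ?thesis using neq one_nV by auto
qed

lemma nV_simple: "is_simple (nV n)"
  unfolding is_simple_def
proof (intro conjI allI impI is_group nV_nontrivial)
  fix N assume N: "N \<lhd> nV n"
  then have "N \<subseteq> carrier (nV n)" using normal_imp_subgroup subgroup.subset by blast
  then show "N = {\<one>\<^bsub>nV n\<^esub>} \<or> N = carrier (nV n)"
    using normal_contains_H[OF N] generated_by_transpositions by auto
qed

end

theorem theorem1:
  fixes n :: enat
  assumes "1 \<le> n"
  shows "generate (nV n) {f. transposition n f} = carrier (nV n) \<and> is_simple (nV n)"
proof -
  interpret cube n by standard (rule assms)
  show ?thesis using generated_by_transpositions nV_simple by blast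
qed

end
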